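(* Let $\Omega\subset\mathbb{R}^2$ be a bounded domain with sufficiently smooth boundary that is not strictly convex or is concave, let $\mu>0$ be the Larmor radius, and consider a $2$-periodic inverse magnetic billiard trajectory in $\Omega$ with successive boundary points $P_0,P_1,P_2,P_3$ and corresponding angles $\theta_0,\theta_1,\theta_2,\theta_3\in(0,\pi)$. Let $\ell_1=|P_0P_1|$ and set $$\alpha=\frac{\ell_1}{\mu},\qquad \beta=\cot(\theta_0)+\cot(\theta_3),\qquad \delta=\cot(\theta_1)+\cot(\theta_2).$$ (i) If $\beta=\delta=0$, then the trajectory is parabolic for all $\alpha\in(0,\infty)$. (ii) If $\beta\le 0$ and $\delta\le 0$ and $\beta$ and $\delta$ are not both zero, then the trajectory is hyperbolic for all $\alpha\in(0,\infty)$. (iii) If either (a) $\beta>0$ and $\delta=0$, or (b) $\beta>0$, $\delta<0$ and $\frac{2}{\beta}+\frac{2}{\delta}\le 0$, then the trajectory is parabolic if and only if $\alpha=\frac{2}{\beta}$; elliptic if and only if $\alpha\in\left(0,\frac{2}{\beta}\right)$; hyperbolic if and only if $\alpha\in\left(\frac{2}{\beta},\infty\right)$. (iv) If $\beta>0$, $\delta<0$ and $\frac{2}{\beta}+\frac{2}{\delta}>0$, then the trajectory is parabolic if and only if $\alpha=\frac{2}{\beta}$ or $\alpha=\frac{2}{\beta}+\frac{2}{\delta}$; elliptic if and only if $\alpha\in\left(\frac{2}{\beta}+\frac{2}{\delta},\frac{2}{\beta}\right)$; hyperbolic if and only if $\alpha\in\left(0,\frac{2}{\beta}+\frac{2}{\delta}\right)\cup\left(\frac{2}{\beta},\infty\right)$.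 (v) If $\beta>0$ and $\delta>0$, let $m=\min\{2/\beta,2/\delta\}$ and $M=\max\{2/\beta,2/\delta\}$. If $\beta\ne\delta$, the trajectory is parabolic if and only if $\alpha\in\{m,M,m+M\}$; elliptic if and only if $\alpha\in(0,m)\cup(M,m+M)$; hyperbolic if and only if $\alpha\in(m,M)\cup(m+M,\infty)$. If $\beta=\delta$, then $m=M$ and the trajectory is parabolic if and only if $\alpha\in\{m,2m\}$; elliptic if and only if $\alpha\in(0,m)\cup(m,2m)$; hyperbolic if and only if $\alpha\in(2m,\infty)$. Moreover, the statements obtained from (iii) and (iv) by interchanging $\beta$ and $\delta$ throughout also hold.
   Context: "Concave" means that $\partial\Omega$ contains points of negative curvature; "not strictly convex" means that $\partial\Omega$ contains points of vanishing curvature. $\Omega$ is connected. Inverse magnetic billiards: a charged particle moves in the plane at constant speed. Inside $\Omega$ it moves along straight lines (no magnetic field); outside $\Omega$ it moves, under a constant magnetic field, along circular arcs (Larmor arcs) of fixed radius $\mu>0$ (the Larmor radius), traversed anticlockwise. The trajectory is a continuous curve and its velocity direction is continuous when it crosses $\partial\Omega$ (Larmor arcs are tangent to the adjacent chords at the crossing points). Parametrize $\partial\Omega=\Gamma(s)$ by arc length $s$ anticlockwise, $L=|\partial\Omega|$. Starting at $P_0=\Gamma(s_0)$ with inward-pointing velocity $v_0$ making angle $\theta_0\in(0,\pi)$ with the positively oriented tangent of $\Gamma$ at $P_0$, the particle moves along a straight chord inside $\Omega$ until it meets $\partial\Omega$ at $P_1=\Gamma(s_1)$; $\theta_1$ is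 the angle between the positively oriented tangent of $\Gamma$ at $P_1$ and $\overrightarrow{P_0P_1}$. It then leaves $\Omega$ and follows the anticlockwise circular arc of radius $\mu$ tangent to the ray $\overrightarrow{P_0P_1}$ at $P_1$, until it re-enters $\Omega$ at $P_2=\Gamma(s_2)$ with velocity $v_2$ making angle $\theta_2$ with the positively oriented tangent of $\Gamma$ at $P_2$. The same convention continues: $P_{2i}$ are re-entry points, $P_{2i+1}$ exit points, $\theta_j$ the angle between the velocity and the positively oriented tangent at $P_j$. The inverse magnetic billiard map is $T:(s_0,\theta_0)\mapsto(s_2,\theta_2)$. A trajectory is $2$-periodic if its initial condition $z$ is a periodic point of $T$ of period $2$ ($T^2(z)=z$, $T(z)\ne z$). Stability: use the area-preserving coordinates $z=(s,u)$ with $u=-\cos\theta$, and let $DT$ be the Jacobian matrix of $T$ in these coordinates, $DT=\begin{pmatrix}\partial s_2/\partial s_0&\partial s_2/\partial u_0\\ \partial u_2/\partial s_0&\partial u_2/\partial u_0\end{pmatrix}$ ($T$ being differentiable at the points of the orbit). For a $2$-periodic orbit the stability matrix is $S_2(z)=DT(T(z))\,DT(z)$. The trajectory is called hyperbolic if $|\operatorname{Tr}S_2(z)|>2$, parabolic if $|\operatorname{Tr}S_2(z)|=2$, and elliptic if $|\operatorname{Tr}S_2(z)|<2$. *)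

theory Defs
  imports "HOL-Analysis.Analysis"
begin

text \<open>The Euclidean plane is the type \<^typ>\<open>complex\<close>: \<open>\<i> * v\<close> is \<open>v\<close> rotated anticlockwise
  by a right angle and \<open>cis t * v\<close> is \<open>v\<close> rotated anticlockwise by the angle \<open>t\<close>.\<close>

definition tangent :: "(real \<Rightarrow> complex) \<Rightarrow> real \<Rightarrow> complex"
  where "tangent \<Gamma> s = vector_derivative \<Gamma> (at s)"

text \<open>\<open>\<Gamma>\<close> is the anticlockwise arc-length parametrization of the boundary of \<open>\<Omega>\<close>, extended
  \<open>L\<close>-periodically to the real line. The boundary is a simple closed curve of class \<open>C\<^sup>2\<close>. The last
  clause is the orientation: \<open>\<Omega>\<close> lies to the left of \<open>\<Gamma>\<close>.\<close>

definition arc_length_boundary :: "complex set \<Rightarrow> (real \<Rightarrow> complex) \<Rightarrow> real \<Rightarrow> bool"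
  where "arc_length_boundary \<Omega> \<Gamma> L \<longleftrightarrow>
    0 < L \<and>
    \<Gamma> C1_differentiable_on UNIV \<and> tangent \<Gamma> C1_differentiable_on UNIV \<and>
    (\<forall>s. norm (tangent \<Gamma> s) = 1) \<and>
    (\<forall>s. \<Gamma> (s + L) = \<Gamma> s) \<and> inj_on \<Gamma> {0..<L} \<and>
    range \<Gamma> = frontier \<Omega> \<and>
    (\<forall>s. \<forall>\<^sub>F r in at_right 0. \<Gamma> s + of_real r * (\<i> * tangent \<Gamma> s) \<in> \<Omega>)"

text \<open>With \<open>\<Omega>\<close> on the left, the curvature of a disc is positive.\<close>

definition signed_curvature :: "(real \<Rightarrow> complex) \<Rightarrow> real \<Rightarrow> real"
  where "signed_curvature \<Gamma> s = vector_derivative (tangent \<Gamma>) (at s) \<bullet> (\<i> * tangent \<Gamma> s)"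

definition not_strictly_convex :: "(real \<Rightarrow> complex) \<Rightarrow> bool"
  where "not_strictly_convex \<Gamma> \<longleftrightarrow> (\<exists>s. signed_curvature \<Gamma> s = 0)"

definition concave_boundary :: "(real \<Rightarrow> complex) \<Rightarrow> bool"
  where "concave_boundary \<Gamma> \<longleftrightarrow> (\<exists>s. signed_curvature \<Gamma> s < 0)"

text \<open>The inward velocity at \<open>\<Gamma> s\<close> with angle \<open>\<theta> \<in> (0, \<pi>)\<close> is the tangent rotated
  anticlockwise by \<open>\<theta>\<close>.\<close>

definition inward_velocity :: "(real \<Rightarrow> complex) \<Rightarrow> real \<times> real \<Rightarrow> complex"
  where "inward_velocity \<Gamma> = (\<lambda>(s, \<theta>). cis \<theta> * tangent \<Gamma> s)"

text \<open>At an exit point \<open>\<theta>\<^sub>1\<close> is the unsigned angle between the tangent and the (outward) unit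
  vector \<open>v\<close>.\<close>

definition chord :: "complex set \<Rightarrow> (real \<Rightarrow> complex) \<Rightarrow> real \<times> real \<Rightarrow> real \<times> real \<Rightarrow> bool"
  where "chord \<Omega> \<Gamma> = (\<lambda>(s\<^sub>0, \<theta>\<^sub>0) (s\<^sub>1, \<theta>\<^sub>1).
    let v = inward_velocity \<Gamma> (s\<^sub>0, \<theta>\<^sub>0) in
      \<theta>\<^sub>0 \<in> {0<..<pi} \<and>
      (\<exists>l>0. \<Gamma> s\<^sub>1 = \<Gamma> s\<^sub>0 + of_real l * v) \<and>
      open_segment (\<Gamma> s\<^sub>0) (\<Gamma> s\<^sub>1) \<subseteq> \<Omega> \<and>
      \<theta>\<^sub>1 = arccos (tangent \<Gamma> s\<^sub>1 \<bullet> v))"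

text \<open>The position, after turning by the angle \<open>t\<close>, on the anticlockwise circle of radius \<open>\<mu>\<close>
  that starts at \<open>p\<close> with unit velocity \<open>v\<close>; its centre is \<open>p + \<mu> * \<i> * v\<close>.\<close>

definition larmor_arc :: "real \<Rightarrow> complex \<Rightarrow> complex \<Rightarrow> real \<Rightarrow> complex"
  where "larmor_arc \<mu> p v t = (p + of_real \<mu> * (\<i> * v)) - of_real \<mu> * (\<i> * (cis t * v))"

text \<open>One chord followed by one Larmor arc: re-entry point, exit point, next re-entry point.
  The arc starts with the velocity \<open>v\<close> of the chord and turns it into \<open>cis t * v\<close>.\<close>

definition billiard_step ::
  "complex set \<Rightarrow> (real \<Rightarrow> complex) \<Rightarrow> real \<Rightarrow> real \<times> real \<Rightarrow> real \<times> real \<Rightarrow> real \<times> real \<Rightarrow> bool"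
  where "billiard_step \<Omega> \<Gamma> \<mu> = (\<lambda>z\<^sub>0 (s\<^sub>1, \<theta>\<^sub>1) (s\<^sub>2, \<theta>\<^sub>2).
    let v = inward_velocity \<Gamma> z\<^sub>0 in
      chord \<Omega> \<Gamma> z\<^sub>0 (s\<^sub>1, \<theta>\<^sub>1) \<and>
      \<theta>\<^sub>2 \<in> {0<..<pi} \<and>
      (\<exists>t\<in>{0<..<2 * pi}.
        (\<forall>r\<in>{0<..<t}. larmor_arc \<mu> (\<Gamma> s\<^sub>1) v r \<notin> closure \<Omega>) \<and>
        larmor_arc \<mu> (\<Gamma> s\<^sub>1) v t = \<Gamma> s\<^sub>2 \<and>
        cis t * v = inward_velocity \<Gamma> (s\<^sub>2, \<theta>\<^sub>2)))"

text \<open>The graph of the billiard map \<open>T\<close>. The arc-length coordinate lives on the circle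
  of length \<open>L\<close>; here it is represented by real numbers, so \<open>w\<close> is determined by \<open>z\<close> up to adding
  multiples of \<open>L\<close> to its first component (see \<open>billiard_step_unique\<close> below).\<close>

definition billiard_map :: "complex set \<Rightarrow> (real \<Rightarrow> complex) \<Rightarrow> real \<Rightarrow> real \<times> real \<Rightarrow> real \<times> real \<Rightarrow> bool"
  where "billiard_map \<Omega> \<Gamma> \<mu> z w \<longleftrightarrow> (\<exists>q. billiard_step \<Omega> \<Gamma> \<mu> z q w)"

definition same_phase_point :: "(real \<Rightarrow> complex) \<Rightarrow> real \<times> real \<Rightarrow> real \<times> real \<Rightarrow> bool"
  where "same_phase_point \<Gamma> = (\<lambda>(s, \<theta>) (s', \<theta>'). \<Gamma> s = \<Gamma> s' \<and> \<theta> = \<theta>')"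

lemma arc_length_boundary_eq_tangent:
  assumes "arc_length_boundary \<Omega> \<Gamma> L" and eq: "\<Gamma> s = \<Gamma> s'"
  shows "tangent \<Gamma> s = tangent \<Gamma> s'"
proof -
  have L: "L > 0" and per: "\<And>x. \<Gamma> (x + L) = \<Gamma> x" and inj: "inj_on \<Gamma> {0..<L}"
    and C: "\<Gamma> C1_differentiable_on UNIV"
    using assms(1) by (auto simp: arc_length_boundary_def)
  have perN: "\<Gamma> (x + real n * L) = \<Gamma> x" for x n
  proof (induction n)
    case (Suc n)
    have "\<Gamma> (x + real (Suc n) * L) = \<Gamma> ((x + real n * L) + L)" by (simp add: algebra_simps)
    then show ?case using per Suc by simp
  qed simp
  have perZ: "\<Gamma> (x + of_int k * L) = \<Gamma> x" for x and k :: int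
  proof (cases "k \<ge> 0")
    case True
    then show ?thesis using perN[of x "nat k"] by simp
  next
    case False
    then show ?thesis using perN[of "x + of_int k * L" "nat (-k)"] by simp
  qed
  have red: "x - of_int \<lfloor>x / L\<rfloor> * L \<in> {0..<L}" for x
  proof -
    have "of_int \<lfloor>x / L\<rfloor> \<le> x / L" "x / L < of_int \<lfloor>x / L\<rfloor> + 1" by linarith+
    then have "of_int \<lfloor>x / L\<rfloor> * L \<le> x" "x < (of_int \<lfloor>x / L\<rfloor> + 1) * L"
      using L by (simp_all only: pos_le_divide_eq pos_divide_less_eq)
    then show ?thesis by (simp add: algebra_simps)
  qed
  have "\<Gamma> (x - of_int \<lfloor>x / L\<rfloor> * L) = \<Gamma> x" for x
    using perZ[of x "- \<lfloor>x / L\<rfloor>"] by simp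
  with eq have "s - of_int \<lfloor>s / L\<rfloor> * L = s' - of_int \<lfloor>s' / L\<rfloor> * L"
    using inj red[of s] red[of s'] by (metis inj_onD)
  then obtain k :: int where k: "s = s' + of_int k * L"
    by (metis (no_types, opaque_lifting) add_diff_eq diff_add_cancel left_diff_distrib of_int_diff
        add.commute)
  have D: "(\<Gamma> has_vector_derivative tangent \<Gamma> x) (at x)" for x
    using C unfolding tangent_def C1_differentiable_on_def
    by (metis UNIV_I vector_derivative_at)
  have "((\<lambda>x. x + of_int k * L) has_vector_derivative 1) (at s')"
    by (auto intro!: derivative_eq_intros)
  then have "((\<lambda>x. \<Gamma> (x + of_int k * L)) has_vector_derivative tangent \<Gamma> s) (at s')"
    using vector_diff_chain_at[of "\<lambda>x. x + of_int k * L" 1 s' \<Gamma> "tangent \<Gamma> s"] D[of s]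
    by (simp add: k o_def)
  then have "(\<Gamma> has_vector_derivative tangent \<Gamma> s) (at s')"
    by (simp add: perZ)
  then show ?thesis by (simp add: tangent_def vector_derivative_at)
qed

lemma billiard_step_unique:
  assumes "open \<Omega>" and B: "arc_length_boundary \<Omega> \<Gamma> L"
    and "billiard_step \<Omega> \<Gamma> \<mu> z q w" and "billiard_step \<Omega> \<Gamma> \<mu> z q' w'"
  shows "same_phase_point \<Gamma> q q' \<and> same_phase_point \<Gamma> w w'"
proof -
  obtain s\<^sub>0 \<theta>\<^sub>0 s\<^sub>1 \<theta>\<^sub>1 s\<^sub>2 \<theta>\<^sub>2 s\<^sub>1' \<theta>\<^sub>1' s\<^sub>2' \<theta>\<^sub>2'
    where z: "z = (s\<^sub>0, \<theta>\<^sub>0)" "q = (s\<^sub>1, \<theta>\<^sub>1)" "w = (s\<^sub>2, \<theta>\<^sub>2)" "q' = (s\<^sub>1', \<theta>\<^sub>1')" "w' = (s\<^sub>2', \<theta>\<^sub>2')"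
    by (metis surj_pair)
  define v where "v = inward_velocity \<Gamma> z"
  have fr: "\<Gamma> s \<in> frontier \<Omega>" for s using B by (auto simp: arc_length_boundary_def)
  then have notin: "\<Gamma> s \<notin> \<Omega>" and incl: "\<Gamma> s \<in> closure \<Omega>" for s
    using \<open>open \<Omega>\<close> by (auto simp: frontier_def interior_open)
  have nt: "norm (tangent \<Gamma> s) = 1" for s using B by (auto simp: arc_length_boundary_def)
  have v0: "v \<noteq> 0" using nt[of s\<^sub>0] by (auto simp: v_def z inward_velocity_def)
  obtain l where l: "l > 0" "\<Gamma> s\<^sub>1 = \<Gamma> s\<^sub>0 + of_real l * v" "open_segment (\<Gamma> s\<^sub>0) (\<Gamma> s\<^sub>1) \<subseteq> \<Omega>"
    and th: "\<theta>\<^sub>1 = arccos (tangent \<Gamma> s\<^sub>1 \<bullet> v)"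
    using assms(3) by (auto simp: billiard_step_def chord_def Let_def z v_def)
  obtain l' where l': "l' > 0" "\<Gamma> s\<^sub>1' = \<Gamma> s\<^sub>0 + of_real l' * v" "open_segment (\<Gamma> s\<^sub>0) (\<Gamma> s\<^sub>1') \<subseteq> \<Omega>"
    and th': "\<theta>\<^sub>1' = arccos (tangent \<Gamma> s\<^sub>1' \<bullet> v)"
    using assms(4) by (auto simp: billiard_step_def chord_def Let_def z v_def)
  have seg: "\<Gamma> s\<^sub>0 + of_real a * v \<in> open_segment (\<Gamma> s\<^sub>0) (\<Gamma> s\<^sub>0 + of_real b * v)"
    if "0 < a" "a < b" for a b
    unfolding in_segment using that v0
    by (auto simp: scaleR_conv_of_real algebra_simps intro!: exI[of _ "a / b"])
  have "l = l'"
    using seg[of l l'] seg[of l' l] l l' notin[of s\<^sub>1] notin[of s\<^sub>1'] by (metis linorder_neqE subsetD)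
  then have G1: "\<Gamma> s\<^sub>1 = \<Gamma> s\<^sub>1'" using l l' by simp
  then have T1: "\<theta>\<^sub>1 = \<theta>\<^sub>1'" using th th' arc_length_boundary_eq_tangent[OF B G1] by simp
  obtain t where t: "t \<in> {0<..<2 * pi}" "\<And>r. r \<in> {0<..<t} \<Longrightarrow> larmor_arc \<mu> (\<Gamma> s\<^sub>1) v r \<notin> closure \<Omega>"
    "larmor_arc \<mu> (\<Gamma> s\<^sub>1) v t = \<Gamma> s\<^sub>2" "cis t * v = inward_velocity \<Gamma> (s\<^sub>2, \<theta>\<^sub>2)"
    and c: "\<theta>\<^sub>2 \<in> {0<..<pi}"
    using assms(3) by (auto simp: billiard_step_def Let_def z v_def)
  obtain t' where t': "t' \<in> {0<..<2 * pi}" "\<And>r. r \<in> {0<..<t'} \<Longrightarrow> larmor_arc \<mu> (\<Gamma> s\<^sub>1) v r \<notin> closure \<Omega>"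
    "larmor_arc \<mu> (\<Gamma> s\<^sub>1) v t' = \<Gamma> s\<^sub>2'" "cis t' * v = inward_velocity \<Gamma> (s\<^sub>2', \<theta>\<^sub>2')"
    and c': "\<theta>\<^sub>2' \<in> {0<..<pi}"
    using assms(4) G1 by (auto simp: billiard_step_def Let_def z v_def)
  have "t = t'"
    using t t' incl[of s\<^sub>2] incl[of s\<^sub>2']
    by (metis greaterThanLessThan_iff linorder_neqE)
  then have G2: "\<Gamma> s\<^sub>2 = \<Gamma> s\<^sub>2'" using t t' by simp
  have "cis \<theta>\<^sub>2 * tangent \<Gamma> s\<^sub>2 = cis \<theta>\<^sub>2' * tangent \<Gamma> s\<^sub>2"
    using t(4) t'(4) \<open>t = t'\<close> arc_length_boundary_eq_tangent[OF B G2]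
    by (metis inward_velocity_def case_prod_conv)
  then have "cis \<theta>\<^sub>2 = cis \<theta>\<^sub>2'" using nt[of s\<^sub>2] by auto
  then have "cos \<theta>\<^sub>2 = cos \<theta>\<^sub>2'" by (simp add: complex_eq_iff)
  then have "\<theta>\<^sub>2 = \<theta>\<^sub>2'" using c c' cos_inj_pi by simp
  then show ?thesis using G1 T1 G2 by (simp add: same_phase_point_def z)
qed

text \<open>\<open>z\<^sub>0, z\<^sub>2\<close> are the re-entry points and \<open>z\<^sub>1, z\<^sub>3\<close> the exit points. Asking for the
  representative \<open>z\<^sub>0\<close> of the second image is no restriction, because \<open>billiard_step\<close> is
  invariant under shifts of the first components by multiples of \<open>L\<close>.\<close>

definition two_periodic_trajectory ::
  "complex set \<Rightarrow> (real \<Rightarrow> complex) \<Rightarrow> real \<Rightarrow>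
    real \<times> real \<Rightarrow> real \<times> real \<Rightarrow> real \<times> real \<Rightarrow> real \<times> real \<Rightarrow> bool"
  where "two_periodic_trajectory \<Omega> \<Gamma> \<mu> z\<^sub>0 z\<^sub>1 z\<^sub>2 z\<^sub>3 \<longleftrightarrow>
    billiard_step \<Omega> \<Gamma> \<mu> z\<^sub>0 z\<^sub>1 z\<^sub>2 \<and> billiard_step \<Omega> \<Gamma> \<mu> z\<^sub>2 z\<^sub>3 z\<^sub>0 \<and>
    \<not> same_phase_point \<Gamma> z\<^sub>2 z\<^sub>0"

text \<open>The area-preserving coordinates \<open>(s, u)\<close> with \<open>u = - cos \<theta>\<close>.\<close>

definition su_coords :: "real \<times> real \<Rightarrow> real^2"
  where "su_coords = (\<lambda>(s, \<theta>). vector [s, - cos \<theta>])"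

text \<open>\<open>T\<close> maps \<open>z\<close> to \<open>w\<close>, is differentiable at \<open>z\<close> in the coordinates \<open>(s, u)\<close>, and \<open>D\<close> is its
  Jacobian matrix there. Differentiability includes that \<open>T\<close> is defined near \<open>z\<close>. \<open>F\<close> is a local
  lift of \<open>T\<close> to real arc-length coordinates; being continuous at \<open>z\<close>, any two such lifts with
  the same value at \<open>z\<close> agree near \<open>z\<close>, so \<open>D\<close> does not depend on \<open>F\<close>.\<close>

definition has_billiard_jacobian ::
  "complex set \<Rightarrow> (real \<Rightarrow> complex) \<Rightarrow> real \<Rightarrow> real \<times> real \<Rightarrow> real \<times> real \<Rightarrow> real^2^2 \<Rightarrow> bool"
  where "has_billiard_jacobian \<Omega> \<Gamma> \<mu> z w D \<longleftrightarrow>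
    billiard_map \<Omega> \<Gamma> \<mu> z w \<and>
    (\<exists>F. F (su_coords z) = su_coords w \<and>
      (\<forall>\<^sub>F x in nhds (su_coords z).
        \<exists>z' w'. x = su_coords z' \<and> billiard_map \<Omega> \<Gamma> \<mu> z' w' \<and> F x = su_coords w') \<and>
      F differentiable at (su_coords z) \<and>
      D = jacobian F (at (su_coords z)))"

definition hyperbolic :: "real^2^2 \<Rightarrow> bool"
  where "hyperbolic S \<longleftrightarrow> \<bar>trace S\<bar> > 2"

definition parabolic :: "real^2^2 \<Rightarrow> bool"
  where "parabolic S \<longleftrightarrow> \<bar>trace S\<bar> = 2"

definition elliptic :: "real^2^2 \<Rightarrow> bool"
  where "elliptic S \<longleftrightarrow> \<bar>trace S\<bar> < 2"

end

theory Submission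
  imports Defs
begin

text \<open>Let \<open>v\<close> and \<open>w\<close> be the velocities along the two chords. Each Larmor arc of the orbit goes from
  an exit point to a re-entry point around a centre that lies at distance \<open>\<mu>\<close> to the left of the
  particle at both ends. Adding up the displacements along the closed orbit, the contributions of
  the two arcs cancel and \<open>l\<^sub>1 v + l\<^sub>3 w = 0\<close> remains. Hence \<open>w = - v\<close>, the two chords have equal
  length and both arcs are half turns: the orbit is a stadium.

  For a variation of a trajectory, record at a boundary point the displacement \<open>x = sin \<theta> ds\<close>
  orthogonal to the velocity, up to sign, and the scaled rotation \<open>\<psi> = \<mu> d\<phi>\<close> of the velocity.
  In these coordinates a chord of length \<open>\<alpha> \<mu>\<close> from \<open>P\<^sub>0\<close> to \<open>P\<^sub>1\<close> followed by a half turn from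
  \<open>P\<^sub>1\<close> to \<open>P\<^sub>2\<close> acts by
  \<open>x\<^sub>2 = - x\<^sub>0 + \<alpha> \<psi>\<^sub>0\<close> and \<open>\<psi>\<^sub>2 = - \<psi>\<^sub>0 + (cot \<theta>\<^sub>1 + cot \<theta>\<^sub>2) x\<^sub>2\<close>,
  in which the curvature of the boundary does not appear: it enters only through the change from
  \<open>(s, u)\<close> to \<open>(x, \<psi>)\<close> (\<open>jacobi_matrix\<close>), and in the product of the two Jacobians these
  changes of coordinates cancel up to conjugation. So the trace of the stability matrix is
  \<open>2 - 2 \<alpha> \<beta> - 2 \<alpha> \<delta> + \<alpha>\<^sup>2 \<beta> \<delta>\<close> (\<open>two_periodic_trace\<close>), whence
  \<open>trace S + 2 = (2 - \<alpha> \<beta>) (2 - \<alpha> \<delta>)\<close> and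
  \<open>trace S - 2 = \<alpha> (\<alpha> \<beta> \<delta> - 2 (\<beta> + \<delta>))\<close>. All cases of the theorem are read off from the signs of
  these two products.

  The linearized relations (\<open>linearized_half_turn_step\<close>) need the exit point as a differentiable
  function of the initial condition, and the centre of the Larmor circle provides one: both ends
  of an arc see the same centre, so near the orbit the exit point is
  \<open>\<Gamma> s\<^sub>2 + \<mu> \<i> v\<^sub>2 - \<mu> \<i> v\<^sub>0\<close>, an explicit function of the initial condition and its image
  under \<open>T\<close>, and differentiable because \<open>T\<close> is. Differentiating the two facts that this
  point lies on the boundary and that it lies on the line of the chord gives the two relations. The
  first of them needs that a differentiable curve within the boundary is tangential to it
  (\<open>curve_in_boundary_tangential\<close>).

  The sign of \<open>cot \<theta>\<^sub>1\<close> rests on the direction in which the boundary is crossed at the exit point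
  (\<open>exit_tangent\<close>): the arc that starts there stays outside of \<open>\<Omega>\<close>, while every direction to the
  left of the boundary leads into \<open>\<Omega>\<close> (\<open>exit_velocity_not_inward\<close>).\<close>

section \<open>The boundary near one of its points\<close>

text \<open>Compactness of a period, together with injectivity, excludes that the boundary curve returns close
  to \<open>\<Gamma> s\<close> at a parameter far from \<open>s\<close>. So the range of \<open>\<Gamma>\<close> looks near \<open>\<Gamma> s\<close> like the image of a
  short parameter interval, up to the choice of the parameter modulo \<open>L\<close>.\<close>

lemma boundary_parameter_close:
  assumes B: "arc_length_boundary \<Omega> \<Gamma> L" and "\<eta> > 0"
  shows "\<exists>d>0. \<forall>s'. dist (\<Gamma> s') (\<Gamma> s) < d \<longrightarrow> (\<exists>r. \<Gamma> r = \<Gamma> s' \<and> \<bar>r - s\<bar> < \<eta>)"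
proof -
  have L: "L > 0" and per: "\<And>x. \<Gamma> (x + L) = \<Gamma> x" and inj: "inj_on \<Gamma> {0..<L}"
    and C: "\<Gamma> C1_differentiable_on UNIV"
    using B by (auto simp: arc_length_boundary_def)
  interpret periodic_fun_simple \<Gamma> L by standard (rule per)
  have cont: "continuous_on A \<Gamma>" for A
    using C1_differentiable_imp_continuous_on[OF C] continuous_on_subset by blast
  have red: "x - of_int \<lfloor>x / L\<rfloor> * L \<in> {0..<L}" for x
    using L floor_divide_lower[of L x] floor_divide_upper[of L x] by (auto simp: algebra_simps)
  have sep: "r = s" if "\<Gamma> r = \<Gamma> s" "\<bar>r - s\<bar> \<le> L / 2" for r
  proof -
    have "r - of_int \<lfloor>r / L\<rfloor> * L = s - of_int \<lfloor>s / L\<rfloor> * L"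
      using that inj red[of r] red[of s] minus_of_int by (metis inj_onD)
    then have e: "r - s = of_int (\<lfloor>r / L\<rfloor> - \<lfloor>s / L\<rfloor>) * L"
      by (simp add: algebra_simps)
    then have "\<bar>of_int (\<lfloor>r / L\<rfloor> - \<lfloor>s / L\<rfloor>) :: real\<bar> * L < 1 * L"
      using that(2) L by (simp add: abs_mult)
    then have "\<bar>of_int (\<lfloor>r / L\<rfloor> - \<lfloor>s / L\<rfloor>) :: real\<bar> < 1"
      using L by (simp only: mult_less_cancel_right_pos)
    then have "\<lfloor>r / L\<rfloor> - \<lfloor>s / L\<rfloor> = 0" by linarith
    then show ?thesis using e by simp
  qed
  define K where "K = cball s (L / 2) - ball s \<eta>"
  have "compact (\<Gamma> ` K)"
    by (intro compact_continuous_image cont) (auto simp: K_def intro: compact_diff)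
  moreover have "\<Gamma> s \<notin> \<Gamma> ` K"
  proof
    assume "\<Gamma> s \<in> \<Gamma> ` K"
    then obtain r where "r \<in> K" "\<Gamma> r = \<Gamma> s" by (metis imageE)
    then show False using sep[of r] \<open>\<eta> > 0\<close> by (auto simp: K_def dist_real_def abs_minus_commute)
  qed
  ultimately obtain d where d: "d > 0" "\<forall>x\<in>\<Gamma> ` K. d \<le> dist (\<Gamma> s) x"
    using separate_point_closed compact_imp_closed by meson
  show ?thesis
  proof (rule exI[of _ d], intro conjI allI impI d(1))
    fix s' assume lt: "dist (\<Gamma> s') (\<Gamma> s) < d"
    \<comment> \<open>The representative of \<open>s'\<close> modulo \<open>L\<close> that is closest to \<open>s\<close>.\<close>
    define r where "r = s' - of_int (round ((s' - s) / L)) * L"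
    have "r - s = ((s' - s) / L - of_int (round ((s' - s) / L))) * L"
      using L by (simp add: r_def left_diff_distrib[of "(s' - s) / L"])
    then have "\<bar>r - s\<bar> = \<bar>(s' - s) / L - of_int (round ((s' - s) / L))\<bar> * L"
      using L by (simp add: abs_mult)
    also have "\<dots> \<le> 1 / 2 * L"
      using of_int_round_abs_le[of "(s' - s) / L"] L
      by (intro mult_right_mono) (auto simp: abs_minus_commute)
    finally have "r \<in> cball s (L / 2)" by (simp add: dist_real_def abs_minus_commute)
    moreover have G: "\<Gamma> r = \<Gamma> s'" by (simp add: r_def minus_of_int)
    moreover have "r \<notin> K" using d(2) lt G by (force simp: dist_commute)
    ultimately show "\<exists>r. \<Gamma> r = \<Gamma> s' \<and> \<bar>r - s\<bar> < \<eta>"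
      by (auto simp: K_def dist_real_def abs_minus_commute)
  qed
qed

lemma boundary_has_tangent:
  assumes "arc_length_boundary \<Omega> \<Gamma> L"
  shows "(\<Gamma> has_vector_derivative tangent \<Gamma> s) (at s)"
  using assms unfolding arc_length_boundary_def tangent_def C1_differentiable_on_def
  by (metis UNIV_I vector_derivative_at)

text \<open>As a set, the boundary is contained near each of its points in arbitrarily thin double cones around
  the tangent. In this form the first order approximation of the boundary applies to a nearby point
  whose parameter is unknown.\<close>

lemma boundary_tangent_cone:
  assumes B: "arc_length_boundary \<Omega> \<Gamma> L" and "\<epsilon> > 0"
  shows "\<exists>d>0. \<forall>s'. dist (\<Gamma> s') (\<Gamma> s) < d \<longrightarrow>
    \<bar>(\<Gamma> s' - \<Gamma> s) \<bullet> (\<i> * tangent \<Gamma> s)\<bar> \<le> \<epsilon> * norm (\<Gamma> s' - \<Gamma> s)"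
proof -
  \<comment> \<open>The bound \<open>1 / 2\<close> makes \<open>\<bar>r - s\<bar>\<close> at most twice the distance in the plane.\<close>
  define e where "e = min (1 / 2) (\<epsilon> / 2)"
  have e: "e > 0" "e \<le> 1 / 2" "2 * e \<le> \<epsilon>" using \<open>\<epsilon> > 0\<close> by (auto simp: e_def)
  have nt: "norm (tangent \<Gamma> s) = 1" using B by (auto simp: arc_length_boundary_def)
  obtain \<eta> where \<eta>: "\<eta> > 0"
    "\<And>r. \<bar>r - s\<bar> < \<eta> \<Longrightarrow> norm (\<Gamma> r - \<Gamma> s - (r - s) *\<^sub>R tangent \<Gamma> s) \<le> e * \<bar>r - s\<bar>"
    using boundary_has_tangent[OF B, of s] e(1)
    unfolding has_vector_derivative_def has_derivative_at_alt by (auto simp: real_norm_def)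
  obtain d where d: "d > 0" "\<And>s'. dist (\<Gamma> s') (\<Gamma> s) < d \<Longrightarrow> \<exists>r. \<Gamma> r = \<Gamma> s' \<and> \<bar>r - s\<bar> < \<eta>"
    using boundary_parameter_close[OF B \<eta>(1)] by meson
  show ?thesis
  proof (intro exI[of _ d] conjI allI impI d(1))
    fix s' assume "dist (\<Gamma> s') (\<Gamma> s) < d"
    then obtain r where r: "\<Gamma> r = \<Gamma> s'" "\<bar>r - s\<bar> < \<eta>" using d(2) by blast
    define R where "R = \<Gamma> r - \<Gamma> s - (r - s) *\<^sub>R tangent \<Gamma> s"
    have R: "norm R \<le> e * \<bar>r - s\<bar>" using \<eta>(2)[OF r(2)] by (simp add: R_def)
    have eq: "\<Gamma> s' - \<Gamma> s = (r - s) *\<^sub>R tangent \<Gamma> s + R" by (simp add: R_def r(1))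
    have "tangent \<Gamma> s \<bullet> (\<i> * tangent \<Gamma> s) = 0" by (simp add: inner_complex_def)
    then have "\<bar>(\<Gamma> s' - \<Gamma> s) \<bullet> (\<i> * tangent \<Gamma> s)\<bar> = \<bar>R \<bullet> (\<i> * tangent \<Gamma> s)\<bar>"
      unfolding eq by (simp add: inner_add_left)
    also have "\<dots> \<le> norm R"
      using Cauchy_Schwarz_ineq2[of R "\<i> * tangent \<Gamma> s"] nt by (simp add: norm_mult)
    finally have 1: "\<bar>(\<Gamma> s' - \<Gamma> s) \<bullet> (\<i> * tangent \<Gamma> s)\<bar> \<le> e * \<bar>r - s\<bar>" using R by linarith
    have "\<bar>r - s\<bar> = norm ((\<Gamma> s' - \<Gamma> s) - R)" unfolding eq using nt by simp
    also have "\<dots> \<le> norm (\<Gamma> s' - \<Gamma> s) + e * \<bar>r - s\<bar>"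
      using norm_triangle_ineq4[of "\<Gamma> s' - \<Gamma> s" R] R by linarith
    also have "\<dots> \<le> norm (\<Gamma> s' - \<Gamma> s) + 1 / 2 * \<bar>r - s\<bar>"
      using mult_right_mono[OF e(2), of "\<bar>r - s\<bar>"] by simp
    finally have "\<bar>r - s\<bar> \<le> 2 * norm (\<Gamma> s' - \<Gamma> s)" by simp
    then have "e * \<bar>r - s\<bar> \<le> e * (2 * norm (\<Gamma> s' - \<Gamma> s))" using e(1) by simp
    also have "\<dots> \<le> \<epsilon> * norm (\<Gamma> s' - \<Gamma> s)"
      using mult_right_mono[OF e(3), of "norm (\<Gamma> s' - \<Gamma> s)"] by simp
    finally show "\<bar>(\<Gamma> s' - \<Gamma> s) \<bullet> (\<i> * tangent \<Gamma> s)\<bar> \<le> \<epsilon> * norm (\<Gamma> s' - \<Gamma> s)"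
      using 1 by linarith
  qed
qed

text \<open>The normal component of the curve is small of higher order by the tangent cone property, and so its
  derivative vanishes.\<close>

lemma curve_in_boundary_tangential:
  assumes B: "arc_length_boundary \<Omega> \<Gamma> L"
    and c: "(c has_vector_derivative w) (at r)" and on: "\<forall>\<^sub>F y in nhds r. c y \<in> range \<Gamma>"
    and s: "c r = \<Gamma> s"
  shows "w \<bullet> (\<i> * tangent \<Gamma> s) = 0"
proof -
  define N where "N = \<i> * tangent \<Gamma> s"
  have "((\<lambda>y. c y \<bullet> N) has_vector_derivative 0) (at r)"
    unfolding has_vector_derivative_def has_derivative_at_alt
  proof (intro conjI allI impI)
    fix e :: real assume "e > 0"
    define \<epsilon> where "\<epsilon> = e / (norm w + 1)"
    have \<epsilon>: "\<epsilon> > 0" "\<epsilon> * (norm w + 1) = e"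
      using \<open>e > 0\<close> norm_ge_zero[of w] by (auto simp: \<epsilon>_def field_simps simp del: norm_ge_zero intro!: divide_pos_pos)
    obtain d\<^sub>1 where d1: "d\<^sub>1 > 0" "\<And>s'. dist (\<Gamma> s') (\<Gamma> s) < d\<^sub>1 \<Longrightarrow> \<bar>(\<Gamma> s' - \<Gamma> s) \<bullet> N\<bar> \<le> \<epsilon> * norm (\<Gamma> s' - \<Gamma> s)"
      using boundary_tangent_cone[OF B \<epsilon>(1)] unfolding N_def by meson
    obtain d\<^sub>2 where d2: "d\<^sub>2 > 0" "\<And>y. norm (y - r) < d\<^sub>2 \<Longrightarrow> norm (c y - c r - (y - r) *\<^sub>R w) \<le> 1 * norm (y - r)"
      using c unfolding has_vector_derivative_def has_derivative_at_alt by (metis zero_less_one)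
    have "isCont c r" using c has_vector_derivative_continuous by blast
    then obtain d\<^sub>3 where d3: "d\<^sub>3 > 0" "\<And>y. dist y r < d\<^sub>3 \<Longrightarrow> dist (c y) (c r) < d\<^sub>1"
      using d1(1) unfolding continuous_at_eps_delta by meson
    obtain d\<^sub>4 where d4: "d\<^sub>4 > 0" "\<And>y. dist y r < d\<^sub>4 \<Longrightarrow> c y \<in> range \<Gamma>"
      using on unfolding eventually_nhds_metric by blast
    show "\<exists>d>0. \<forall>y. norm (y - r) < d \<longrightarrow>
        norm (c y \<bullet> N - c r \<bullet> N - (y - r) *\<^sub>R 0) \<le> e * norm (y - r)"
    proof (intro exI[of _ "min d\<^sub>2 (min d\<^sub>3 d\<^sub>4)"] conjI allI impI)
      fix y assume "norm (y - r) < min d\<^sub>2 (min d\<^sub>3 d\<^sub>4)"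
      then have y: "norm (y - r) < d\<^sub>2" "dist y r < d\<^sub>3" "dist y r < d\<^sub>4" by (auto simp: dist_norm)
      obtain s' where s': "c y = \<Gamma> s'" using d4(2)[OF y(3)] by auto
      have "\<bar>(c y - c r) \<bullet> N\<bar> \<le> \<epsilon> * norm (c y - c r)"
        using d1(2)[of s'] d3(2)[OF y(2)] by (simp add: s s')
      also have "norm (c y - c r) \<le> norm (c y - c r - (y - r) *\<^sub>R w) + norm ((y - r) *\<^sub>R w)"
        using norm_triangle_ineq[of "c y - c r - (y - r) *\<^sub>R w" "(y - r) *\<^sub>R w"] by simp
      then have "norm (c y - c r) \<le> (norm w + 1) * norm (y - r)"
        using d2(2)[OF y(1)] by (simp only: norm_scaleR distrib_right mult.commute[of "norm w"]) (simp add: real_norm_def)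
      then have "\<epsilon> * norm (c y - c r) \<le> e * norm (y - r)"
        using mult_left_mono[of _ _ \<epsilon>] \<epsilon> by (metis less_eq_real_def mult.assoc)
      finally show "norm (c y \<bullet> N - c r \<bullet> N - (y - r) *\<^sub>R 0) \<le> e * norm (y - r)"
        by (simp add: inner_diff_left)
    qed (use d2 d3 d4 in auto)
  qed (simp add: bounded_linear_zero)
  moreover have "((\<lambda>y. c y \<bullet> N) has_vector_derivative w \<bullet> N) (at r)"
    using bounded_linear.has_vector_derivative[OF bounded_linear_inner_left c] .
  ultimately show ?thesis unfolding N_def using vector_derivative_unique_at by blast
qed

lemma larmor_arc_0: "larmor_arc \<mu> p v 0 = p"
  by (simp add: larmor_arc_def)

lemma larmor_arc_velocity_0: "(larmor_arc \<mu> p v has_vector_derivative of_real \<mu> * v) (at 0)"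
proof -
  have "(cis has_vector_derivative \<i> * cis 0) (at 0)"
    unfolding has_vector_derivative_def by (intro has_derivative_cis has_derivative_ident)
  then have "((\<lambda>t. cis t * v) has_vector_derivative \<i> * v) (at 0)"
    using has_vector_derivative_mult_left by fastforce
  then have "((\<lambda>t. of_real \<mu> * (\<i> * (cis t * v))) has_vector_derivative of_real \<mu> * (\<i> * (\<i> * v))) (at 0)"
    by (intro has_vector_derivative_mult_right)
  from has_vector_derivative_diff[OF has_vector_derivative_const[of "p + of_real \<mu> * (\<i> * v)"] this]
  show ?thesis by (simp add: larmor_arc_def[abs_def])
qed

text \<open>Suppose that \<open>v\<close> points to the left of the boundary. For small \<open>r\<close> compare the point \<open>a\<close> of the
  arc with the point \<open>b\<close> at distance \<open>\<mu> r\<close> from \<open>\<Gamma> s\<close> along the inner normal, which lies in \<open>\<Omega>\<close>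
  by the orientation of the boundary. The whole segment from \<open>a\<close> to \<open>b\<close> keeps away from the tangent
  at \<open>\<Gamma> s\<close> by an amount proportional to \<open>r\<close> and so avoids the thin cones that contain the
  boundary. Hence \<open>a\<close> also lies in \<open>\<Omega>\<close>, a contradiction.\<close>

lemma exit_velocity_not_inward:
  assumes B: "arc_length_boundary \<Omega> \<Gamma> L" and "\<mu> > 0" and v: "norm v = 1" and "t > 0"
    and out: "\<forall>r\<in>{0<..<t}. larmor_arc \<mu> (\<Gamma> s) v r \<notin> \<Omega>"
  shows "v \<bullet> (\<i> * tangent \<Gamma> s) \<le> 0"
proof (rule ccontr)
  define N where "N = \<i> * tangent \<Gamma> s"
  define c where "c = v \<bullet> N"
  assume "\<not> ?thesis"
  then have c0: "c > 0" by (simp add: c_def N_def)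
  have nN: "norm N = 1" using B by (simp add: N_def arc_length_boundary_def norm_mult)
  then have c1: "c \<le> 1" using Cauchy_Schwarz_ineq2[of v N] v by (simp add: c_def)
  have fr: "range \<Gamma> = frontier \<Omega>" using B by (simp add: arc_length_boundary_def)
  obtain d where d: "d > 0" "\<And>s'. dist (\<Gamma> s') (\<Gamma> s) < d \<Longrightarrow> \<bar>(\<Gamma> s' - \<Gamma> s) \<bullet> N\<bar> \<le> c / 8 * norm (\<Gamma> s' - \<Gamma> s)"
    using boundary_tangent_cone[OF B, of "c / 8"] c0 unfolding N_def by auto
  obtain d\<^sub>2 where d2: "d\<^sub>2 > 0" "\<And>r. \<bar>r\<bar> < d\<^sub>2 \<Longrightarrow>
      norm (larmor_arc \<mu> (\<Gamma> s) v r - \<Gamma> s - r *\<^sub>R (of_real \<mu> * v)) \<le> \<mu> * c / 2 * \<bar>r\<bar>"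
  proof -
    have "\<mu> * c / 2 > 0" using c0 \<open>\<mu> > 0\<close> by simp
    with larmor_arc_velocity_0[of \<mu> "\<Gamma> s" v]
    have "\<exists>d>0. \<forall>y. norm (y - 0) < d \<longrightarrow>
        norm (larmor_arc \<mu> (\<Gamma> s) v y - larmor_arc \<mu> (\<Gamma> s) v 0 - (y - 0) *\<^sub>R (of_real \<mu> * v))
          \<le> \<mu> * c / 2 * norm (y - 0)"
      unfolding has_vector_derivative_def has_derivative_at_alt by blast
    then show ?thesis using that by (auto simp: larmor_arc_0 real_norm_def)
  qed
  obtain d\<^sub>3 where d3: "d\<^sub>3 > 0" "\<And>r. 0 < r \<Longrightarrow> r < d\<^sub>3 \<Longrightarrow> \<Gamma> s + of_real r * N \<in> \<Omega>"
    using B unfolding arc_length_boundary_def eventually_at_right_field N_def by blast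
  \<comment> \<open>Small enough for the arc to be outside, for its linear approximation to hold, for the normal to
    run inside, and for the segment to stay in the range of the tangent cone property.\<close>
  define r where "r = min (t / 2) (min (d\<^sub>2 / 2) (min (d\<^sub>3 / (2 * \<mu>)) (d / (4 * \<mu>))))"
  have r0: "r > 0" using \<open>t > 0\<close> d d2 d3 \<open>\<mu> > 0\<close> by (simp add: r_def)
  have rt: "r < t" and rd2: "\<bar>r\<bar> < d\<^sub>2" using r0 \<open>t > 0\<close> d2(1) by (auto simp: r_def)
  have "r \<le> d\<^sub>3 / (2 * \<mu>)" "r \<le> d / (4 * \<mu>)" by (auto simp: r_def)
  then have "\<mu> * r \<le> d\<^sub>3 / 2" "2 * (\<mu> * r) \<le> d / 2" using \<open>\<mu> > 0\<close> by (auto simp: field_simps)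
  then have rd3: "\<mu> * r < d\<^sub>3" and rd: "2 * (\<mu> * r) < d" using d(1) d3(1) by linarith+
  define m where "m = \<mu> * r"
  have m0: "m > 0" using r0 \<open>\<mu> > 0\<close> by (simp add: m_def)
  define a where "a = larmor_arc \<mu> (\<Gamma> s) v r"
  define b where "b = \<Gamma> s + of_real m * N"
  have b: "b \<in> \<Omega>" using d3(2)[of m] rd3 m0 by (simp add: b_def m_def)
  define R where "R = a - \<Gamma> s - m *\<^sub>R v"
  have nR: "norm R \<le> m * c / 2"
    using d2(2)[OF rd2] r0 by (simp add: R_def a_def m_def scaleR_conv_of_real mult_ac)
  have a: "a - \<Gamma> s = m *\<^sub>R v + R" by (simp add: R_def)
  have mc: "m * c \<le> m" using c1 m0 mult_left_mono[of c 1 m] by simp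
  have na: "norm (a - \<Gamma> s) \<le> 2 * m"
  proof -
    have "norm (m *\<^sub>R v) = m" using v m0 by simp
    then show ?thesis using norm_triangle_ineq[of "m *\<^sub>R v" R] nR mc m0 unfolding a by linarith
  qed
  have "\<bar>R \<bullet> N\<bar> \<le> m * c / 2" using Cauchy_Schwarz_ineq2[of R N] nR nN by simp
  then have ia: "(a - \<Gamma> s) \<bullet> N \<ge> m * c / 2"
  proof -
    have "(a - \<Gamma> s) \<bullet> N = m * c + R \<bullet> N" unfolding a by (simp add: inner_add_left c_def)
    then show ?thesis using \<open>\<bar>R \<bullet> N\<bar> \<le> m * c / 2\<close> by linarith
  qed
  have bG: "b - \<Gamma> s = m *\<^sub>R N" by (simp add: b_def scaleR_conv_of_real)
  have nb: "norm (b - \<Gamma> s) = m" and ib: "(b - \<Gamma> s) \<bullet> N = m"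
    using nN m0 by (auto simp: bG dot_square_norm)
  have "closed_segment a b \<inter> frontier \<Omega> = {}"
  proof (rule ccontr)
    assume "\<not> ?thesis"
    then obtain s' where s': "\<Gamma> s' \<in> closed_segment a b" unfolding fr[symmetric] by blast
    then obtain x where x: "0 \<le> x" "x \<le> 1" and "\<Gamma> s' = (1 - x) *\<^sub>R a + x *\<^sub>R b"
      by (auto simp: in_segment)
    then have e: "\<Gamma> s' - \<Gamma> s = (1 - x) *\<^sub>R (a - \<Gamma> s) + x *\<^sub>R (b - \<Gamma> s)"
      by (simp add: algebra_simps)
    have "norm (\<Gamma> s' - \<Gamma> s) \<le> (1 - x) * norm (a - \<Gamma> s) + x * norm (b - \<Gamma> s)"
      unfolding e using norm_triangle_ineq[of "(1 - x) *\<^sub>R (a - \<Gamma> s)" "x *\<^sub>R (b - \<Gamma> s)"] x by simp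
    also have "\<dots> \<le> (1 - x) * (2 * m) + x * (2 * m)"
      using x na nb m0 by (intro add_mono mult_left_mono) auto
    finally have n: "norm (\<Gamma> s' - \<Gamma> s) \<le> 2 * m"
      unfolding distrib_right[symmetric] by simp
    have "(1 - x) * (m * c / 2) + x * (m * c / 2) \<le> (\<Gamma> s' - \<Gamma> s) \<bullet> N"
      unfolding e inner_add_left inner_scaleR_left
      using x ia ib mc m0 c0 by (intro add_mono mult_left_mono) auto
    then have i: "m * c / 2 \<le> (\<Gamma> s' - \<Gamma> s) \<bullet> N"
      unfolding distrib_right[symmetric] by simp
    have "\<bar>(\<Gamma> s' - \<Gamma> s) \<bullet> N\<bar> \<le> c / 8 * norm (\<Gamma> s' - \<Gamma> s)"
      using n rd by (intro d(2)) (simp add: dist_norm m_def)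
    also have "\<dots> \<le> c / 8 * (2 * m)" using n c0 by (intro mult_left_mono) auto
    finally show False using i mult_pos_pos[OF m0 c0] by (simp add: mult_ac)
  qed
  then have "a \<in> \<Omega>"
    using connected_Int_frontier[of "closed_segment a b" \<Omega>] b by auto
  then show False using out r0 rt by (auto simp: a_def)
qed

text \<open>The angle \<open>\<theta>\<^sub>1\<close> is defined without a sign, by its cosine. That the tangent is the velocity rotated
  anticlockwise by \<open>\<theta>\<^sub>1\<close>, and not clockwise, is the statement that the particle leaves \<open>\<Omega>\<close> there.\<close>

lemma exit_tangent:
  assumes B: "arc_length_boundary \<Omega> \<Gamma> L" and "\<mu> > 0"
    and step: "billiard_step \<Omega> \<Gamma> \<mu> z (s\<^sub>1, \<theta>\<^sub>1) w" and th: "\<theta>\<^sub>1 \<in> {0<..<pi}"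
  shows "tangent \<Gamma> s\<^sub>1 = cis \<theta>\<^sub>1 * inward_velocity \<Gamma> z"
proof -
  define v where "v = inward_velocity \<Gamma> z"
  define T where "T = tangent \<Gamma> s\<^sub>1"
  obtain s\<^sub>0 \<theta>\<^sub>0 s\<^sub>2 \<theta>\<^sub>2 where zw: "z = (s\<^sub>0, \<theta>\<^sub>0)" "w = (s\<^sub>2, \<theta>\<^sub>2)" by fastforce
  have nt: "norm (tangent \<Gamma> s) = 1" for s using B by (auto simp: arc_length_boundary_def)
  have v: "norm v = 1" by (simp add: v_def zw inward_velocity_def norm_mult nt)
  have ar: "\<theta>\<^sub>1 = arccos (T \<bullet> v)"
    and "\<exists>t>0. \<forall>r\<in>{0<..<t}. larmor_arc \<mu> (\<Gamma> s\<^sub>1) v r \<notin> closure \<Omega>"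
    using step by (auto simp: billiard_step_def chord_def Let_def zw v_def T_def)
  then obtain t where "t > 0" "\<forall>r\<in>{0<..<t}. larmor_arc \<mu> (\<Gamma> s\<^sub>1) v r \<notin> \<Omega>"
    using closure_subset by blast
  then have "v \<bullet> (\<i> * T) \<le> 0"
    unfolding T_def by (intro exit_velocity_not_inward[OF B \<open>\<mu> > 0\<close> v])
  then have le: "Im v * Re T - Re v * Im T \<le> 0" by (simp add: inner_complex_def)
  have "\<bar>T \<bullet> v\<bar> \<le> 1" using Cauchy_Schwarz_ineq2[of T v] v nt by (simp add: T_def)
  then have cos: "cos \<theta>\<^sub>1 = T \<bullet> v" unfolding ar by (simp add: cos_arccos_abs)
  have sin: "sin \<theta>\<^sub>1 > 0" using th sin_gt_zero by auto
  have T1: "(Re T)\<^sup>2 + (Im T)\<^sup>2 = 1" and v1: "(Re v)\<^sup>2 + (Im v)\<^sup>2 = 1"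
    using nt[of s\<^sub>1] v by (auto simp: T_def cmod_def)
  have "(sin \<theta>\<^sub>1)\<^sup>2 = (Re v * Im T - Im v * Re T)\<^sup>2"
  proof -
    have "(Re v * Im T - Im v * Re T)\<^sup>2 + (T \<bullet> v)\<^sup>2
        = ((Re T)\<^sup>2 + (Im T)\<^sup>2) * ((Re v)\<^sup>2 + (Im v)\<^sup>2)"
      by (simp add: inner_complex_def power2_eq_square algebra_simps)
    then show ?thesis unfolding T1 v1 using cos sin_squared_eq[of \<theta>\<^sub>1] by simp
  qed
  then have s: "sin \<theta>\<^sub>1 = Re v * Im T - Im v * Re T"
    using sin le by (simp add: power2_eq_iff)
  have c: "cos \<theta>\<^sub>1 = Re T * Re v + Im T * Im v" using cos by (simp add: inner_complex_def)
  have "T = cis \<theta>\<^sub>1 * v"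
  proof (rule complex_eqI)
    have "Re T = Re T * ((Re v)\<^sup>2 + (Im v)\<^sup>2)" by (simp add: v1)
    also have "\<dots> = Re (cis \<theta>\<^sub>1 * v)" by (simp add: s c power2_eq_square algebra_simps)
    finally show "Re T = Re (cis \<theta>\<^sub>1 * v)" .
    have "Im T = Im T * ((Re v)\<^sup>2 + (Im v)\<^sup>2)" by (simp add: v1)
    also have "\<dots> = Im (cis \<theta>\<^sub>1 * v)" by (simp add: s c power2_eq_square algebra_simps)
    finally show "Im T = Im (cis \<theta>\<^sub>1 * v)" .
  qed
  then show ?thesis by (simp add: T_def v_def)
qed

section \<open>The stadium shape of two-periodic orbits\<close>

text \<open>What the computations use of a billiard step: the exit point is the end of the chord, and the centre
  of the Larmor circle, seen from both ends of the arc, is the same point.\<close>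

lemma billiard_step_geometry:
  assumes B: "arc_length_boundary \<Omega> \<Gamma> L" and step: "billiard_step \<Omega> \<Gamma> \<mu> (s\<^sub>0, \<theta>\<^sub>0) (s\<^sub>1, \<theta>\<^sub>1) (s\<^sub>2, \<theta>\<^sub>2)"
  defines "v \<equiv> inward_velocity \<Gamma> (s\<^sub>0, \<theta>\<^sub>0)" and "w \<equiv> inward_velocity \<Gamma> (s\<^sub>2, \<theta>\<^sub>2)"
  shows "\<theta>\<^sub>0 \<in> {0<..<pi}" and "\<theta>\<^sub>2 \<in> {0<..<pi}" and "norm v = 1" and "norm w = 1"
    and "dist (\<Gamma> s\<^sub>0) (\<Gamma> s\<^sub>1) > 0"
    and "\<Gamma> s\<^sub>1 = \<Gamma> s\<^sub>0 + of_real (dist (\<Gamma> s\<^sub>0) (\<Gamma> s\<^sub>1)) * v"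
    and "\<Gamma> s\<^sub>1 + of_real \<mu> * (\<i> * v) = \<Gamma> s\<^sub>2 + of_real \<mu> * (\<i> * w)"
proof -
  have nt: "norm (tangent \<Gamma> s) = 1" for s using B by (auto simp: arc_length_boundary_def)
  show v: "norm v = 1" and "norm w = 1"
    by (simp_all add: v_def w_def inward_velocity_def norm_mult nt)
  show "\<theta>\<^sub>0 \<in> {0<..<pi}" and "\<theta>\<^sub>2 \<in> {0<..<pi}"
    using step by (auto simp: billiard_step_def chord_def Let_def)
  obtain l where l: "l > 0" "\<Gamma> s\<^sub>1 = \<Gamma> s\<^sub>0 + of_real l * v"
    using step by (auto simp: billiard_step_def chord_def Let_def v_def)
  then have "dist (\<Gamma> s\<^sub>0) (\<Gamma> s\<^sub>1) = l" using v by (simp add: dist_norm norm_mult)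
  then show "dist (\<Gamma> s\<^sub>0) (\<Gamma> s\<^sub>1) > 0"
    and "\<Gamma> s\<^sub>1 = \<Gamma> s\<^sub>0 + of_real (dist (\<Gamma> s\<^sub>0) (\<Gamma> s\<^sub>1)) * v" using l by auto
  obtain t where t: "larmor_arc \<mu> (\<Gamma> s\<^sub>1) v t = \<Gamma> s\<^sub>2" "cis t * v = w"
    using step by (auto simp: billiard_step_def Let_def v_def w_def)
  show "\<Gamma> s\<^sub>1 + of_real \<mu> * (\<i> * v) = \<Gamma> s\<^sub>2 + of_real \<mu> * (\<i> * w)"
    unfolding t(1)[symmetric] t(2)[symmetric] by (simp add: larmor_arc_def)
qed

text \<open>The closed orbit consists of two chords and two arcs. The displacements along the arcs are
  \<open>\<mu> \<i> (v - w)\<close> and \<open>\<mu> \<i> (w - v)\<close> and cancel. So the chord vectors also cancel, and since \<open>v\<close> and \<open>w\<close>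
  are unit vectors and lengths are positive, nothing but a stadium is possible.\<close>

lemma two_periodic_stadium:
  assumes B: "arc_length_boundary \<Omega> \<Gamma> L"
    and "two_periodic_trajectory \<Omega> \<Gamma> \<mu> (s\<^sub>0, \<theta>\<^sub>0) (s\<^sub>1, \<theta>\<^sub>1) (s\<^sub>2, \<theta>\<^sub>2) (s\<^sub>3, \<theta>\<^sub>3)"
  shows "inward_velocity \<Gamma> (s\<^sub>2, \<theta>\<^sub>2) = - inward_velocity \<Gamma> (s\<^sub>0, \<theta>\<^sub>0)"
    and "dist (\<Gamma> s\<^sub>2) (\<Gamma> s\<^sub>3) = dist (\<Gamma> s\<^sub>0) (\<Gamma> s\<^sub>1)"
proof -
  define v where "v = inward_velocity \<Gamma> (s\<^sub>0, \<theta>\<^sub>0)"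
  define w where "w = inward_velocity \<Gamma> (s\<^sub>2, \<theta>\<^sub>2)"
  define l where "l = dist (\<Gamma> s\<^sub>0) (\<Gamma> s\<^sub>1)"
  define l' where "l' = dist (\<Gamma> s\<^sub>2) (\<Gamma> s\<^sub>3)"
  have s: "billiard_step \<Omega> \<Gamma> \<mu> (s\<^sub>0, \<theta>\<^sub>0) (s\<^sub>1, \<theta>\<^sub>1) (s\<^sub>2, \<theta>\<^sub>2)"
    "billiard_step \<Omega> \<Gamma> \<mu> (s\<^sub>2, \<theta>\<^sub>2) (s\<^sub>3, \<theta>\<^sub>3) (s\<^sub>0, \<theta>\<^sub>0)"
    using assms by (auto simp: two_periodic_trajectory_def)
  note g = billiard_step_geometry[OF B s(1), folded v_def w_def l_def]
    billiard_step_geometry[OF B s(2), folded v_def w_def l'_def]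
  have "of_real l * v + of_real l' * w
      = (\<Gamma> s\<^sub>1 + of_real \<mu> * (\<i> * v) - (\<Gamma> s\<^sub>2 + of_real \<mu> * (\<i> * w)))
        + (\<Gamma> s\<^sub>3 + of_real \<mu> * (\<i> * w) - (\<Gamma> s\<^sub>0 + of_real \<mu> * (\<i> * v)))"
    unfolding g(6) g(13) by simp
  also have "\<dots> = 0" unfolding g(7) g(14) by simp
  finally have e: "of_real l' * w = - (of_real l * v)" by (simp add: eq_neg_iff_add_eq_0 add.commute)
  then have "norm (of_real l' * w) = norm (of_real l * v)" by simp
  then have "l' = l" using g(3,4,5,12) by (simp add: norm_mult)
  moreover have "w = - v"
  proof -
    have "of_real l * (w + v) = 0" using e \<open>l' = l\<close> by (simp add: distrib_left)
    then show ?thesis using g(5) by (simp add: eq_neg_iff_add_eq_0)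
  qed
  ultimately show "inward_velocity \<Gamma> (s\<^sub>2, \<theta>\<^sub>2) = - inward_velocity \<Gamma> (s\<^sub>0, \<theta>\<^sub>0)"
    "dist (\<Gamma> s\<^sub>2) (\<Gamma> s\<^sub>3) = dist (\<Gamma> s\<^sub>0) (\<Gamma> s\<^sub>1)"
    by (simp_all add: v_def w_def l_def l'_def)
qed

section \<open>Linearization of a step with a half turn\<close>

text \<open>Frenet equation: the derivative of a unit vector is orthogonal to it, and so only its component
  along the normal, the signed curvature, survives.\<close>

lemma tangent_has_derivative:
  assumes B: "arc_length_boundary \<Omega> \<Gamma> L"
  shows "(tangent \<Gamma> has_vector_derivative of_real (signed_curvature \<Gamma> s) * (\<i> * tangent \<Gamma> s)) (at s)"
proof -
  define T where "T = tangent \<Gamma> s"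
  define N where "N = vector_derivative (tangent \<Gamma>) (at s)"
  have nt: "norm (tangent \<Gamma> x) = 1" for x using B by (auto simp: arc_length_boundary_def)
  have D: "(tangent \<Gamma> has_vector_derivative N) (at s)"
    using B unfolding arc_length_boundary_def C1_differentiable_on_def N_def
    by (metis UNIV_I vector_derivative_at)
  have "((\<lambda>x. tangent \<Gamma> x \<bullet> tangent \<Gamma> x) has_vector_derivative T \<bullet> N + N \<bullet> T) (at s)"
    using bounded_bilinear.has_vector_derivative[OF bounded_bilinear_inner D D] by (simp add: T_def)
  moreover have "(\<lambda>x. tangent \<Gamma> x \<bullet> tangent \<Gamma> x) = (\<lambda>x. 1)"
    using nt by (simp add: dot_square_norm)
  ultimately have "T \<bullet> N + N \<bullet> T = 0"
    using vector_derivative_unique_at has_vector_derivative_const by metis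
  then have 0: "Re T * Re N + Im T * Im N = 0" by (simp add: inner_complex_def algebra_simps)
  have 1: "Re T * Re T + Im T * Im T = 1"
    using nt[of s] by (simp add: T_def cmod_def power2_eq_square)
  have k: "signed_curvature \<Gamma> s = Im N * Re T - Re N * Im T"
    by (simp add: signed_curvature_def N_def T_def inner_complex_def)
  have "N = of_real (signed_curvature \<Gamma> s) * (\<i> * T)"
  proof (rule complex_eqI)
    have "Re N = Re N * (Re T * Re T + Im T * Im T)" using 1 by simp
    also have "\<dots> = - (Im N * Re T - Re N * Im T) * Im T + Re T * (Re T * Re N + Im T * Im N)"
      by (simp add: algebra_simps)
    also have "\<dots> = Re (of_real (signed_curvature \<Gamma> s) * (\<i> * T))"
      unfolding 0 by (simp add: k algebra_simps)
    finally show "Re N = Re (of_real (signed_curvature \<Gamma> s) * (\<i> * T))" .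
    have "Im N = Im N * (Re T * Re T + Im T * Im T)" using 1 by simp
    also have "\<dots> = (Im N * Re T - Re N * Im T) * Re T + Im T * (Re T * Re N + Im T * Im N)"
      by (simp add: algebra_simps)
    also have "\<dots> = Im (of_real (signed_curvature \<Gamma> s) * (\<i> * T))"
      unfolding 0 by (simp add: k algebra_simps)
    finally show "Im N = Im (of_real (signed_curvature \<Gamma> s) * (\<i> * T))" .
  qed
  then show ?thesis using D by (simp add: T_def)
qed

text \<open>The inward velocity as a function of \<open>(s, u)\<close>, differentiable for \<open>\<bar>u\<bar> < 1\<close>: since
  \<open>u = - cos \<theta>\<close> and \<open>0 < \<theta> < \<pi>\<close>, the square root is \<open>sin \<theta>\<close>.\<close>

definition su_velocity :: "(real \<Rightarrow> complex) \<Rightarrow> real^2 \<Rightarrow> complex"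
  where "su_velocity \<Gamma> x = Complex (- x $ 2) (sqrt (1 - (x $ 2)\<^sup>2)) * tangent \<Gamma> (x $ 1)"

lemma su_coords_components [simp]: "su_coords (s, \<theta>) $ 1 = s" "su_coords (s, \<theta>) $ 2 = - cos \<theta>"
  by (simp_all add: su_coords_def)

lemma su_velocity_su_coords:
  assumes "\<theta> \<in> {0<..<pi}"
  shows "su_velocity \<Gamma> (su_coords (s, \<theta>)) = inward_velocity \<Gamma> (s, \<theta>)"
proof -
  have "sqrt (1 - (cos \<theta>)\<^sup>2) = sin \<theta>"
    using sin_gt_zero[of \<theta>] assms by (simp flip: sin_squared_eq)
  then show ?thesis
    by (simp add: su_velocity_def inward_velocity_def complex_eq_iff)
qed

text \<open>Sends \<open>(ds, du)\<close> to \<open>(x, \<psi>) = (sin \<theta> ds, \<mu> d\<phi>)\<close>, where \<open>\<phi>\<close> is the direction of the velocity: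
  \<open>d\<phi> = \<kappa> ds + d\<theta>\<close> with the curvature \<open>\<kappa>\<close>, and \<open>du = sin \<theta> d\<theta>\<close>.\<close>

definition jacobi_matrix :: "(real \<Rightarrow> complex) \<Rightarrow> real \<Rightarrow> real \<times> real \<Rightarrow> real^2^2"
  where "jacobi_matrix \<Gamma> \<mu> = (\<lambda>(s, \<theta>).
    vector [vector [sin \<theta>, 0], vector [\<mu> * signed_curvature \<Gamma> s, \<mu> / sin \<theta>]])"

text \<open>A unit vector moves by rotation; the real factor is the angular velocity \<open>d\<phi>\<close> of the entry
  \<open>\<psi> = \<mu> d\<phi>\<close> in \<open>jacobi_matrix\<close>.\<close>

lemma su_velocity_derivative:
  assumes B: "arc_length_boundary \<Omega> \<Gamma> L" and th: "\<theta> \<in> {0<..<pi}"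
    and x: "(x has_vector_derivative h) (at r)" and xr: "x r = su_coords (s, \<theta>)"
  shows "((\<lambda>y. su_velocity \<Gamma> (x y)) has_vector_derivative
    of_real (signed_curvature \<Gamma> s * h $ 1 + h $ 2 / sin \<theta>) * (\<i> * inward_velocity \<Gamma> (s, \<theta>))) (at r)"
proof -
  have sin: "sin \<theta> > 0" using th sin_gt_zero[of \<theta>] by auto
  have sq: "sqrt (1 - (cos \<theta>)\<^sup>2) = sin \<theta>"
    using sin by (simp flip: sin_squared_eq)
  have x12: "((\<lambda>y. x y $ i) has_vector_derivative h $ i) (at r)" for i
    using bounded_linear.has_vector_derivative[OF bounded_linear_vec_nth x] .
  have xr12: "x r $ 1 = s" "x r $ 2 = - cos \<theta>" using xr by auto
  have u: "((\<lambda>y. x y $ 2) has_real_derivative h $ 2) (at r)"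
    using x12[of 2] by (simp add: has_real_derivative_iff_has_vector_derivative)
  have "((\<lambda>y. sqrt (1 - (x y $ 2)\<^sup>2)) has_real_derivative cos \<theta> * h $ 2 / sin \<theta>) (at r)"
    by (rule derivative_eq_intros refl u | use sq sin xr12 in \<open>simp add: field_simps flip: sin_squared_eq\<close>)+
  then have im: "((\<lambda>y. complex_of_real (sqrt (1 - (x y $ 2)\<^sup>2))) has_vector_derivative
      complex_of_real (cos \<theta> * h $ 2 / sin \<theta>)) (at r)"
    unfolding has_real_derivative_iff_has_vector_derivative
    using bounded_linear.has_vector_derivative[OF bounded_linear_of_real] by blast
  have re: "((\<lambda>y. complex_of_real (x y $ 2)) has_vector_derivative of_real (h $ 2)) (at r)"
    using bounded_linear.has_vector_derivative[OF bounded_linear_of_real x12] .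
  have dir: "((\<lambda>y. Complex (- x y $ 2) (sqrt (1 - (x y $ 2)\<^sup>2))) has_vector_derivative
      - of_real (h $ 2) + \<i> * of_real (cos \<theta> * h $ 2 / sin \<theta>)) (at r)"
    unfolding Complex_eq of_real_minus
    by (intro has_vector_derivative_add has_vector_derivative_minus has_vector_derivative_mult_right re im)
  have tan: "((\<lambda>y. tangent \<Gamma> (x y $ 1)) has_vector_derivative
      h $ 1 *\<^sub>R (of_real (signed_curvature \<Gamma> s) * (\<i> * tangent \<Gamma> s))) (at r)"
    using vector_diff_chain_at[OF x12[of 1], of "tangent \<Gamma>"] tangent_has_derivative[OF B, of s]
    by (simp add: o_def xr12)
  have "Complex (- x r $ 2) (sqrt (1 - (x r $ 2)\<^sup>2)) = cis \<theta>"
    by (simp add: xr12 sq complex_eq_iff)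
  then have D: "((\<lambda>y. su_velocity \<Gamma> (x y)) has_vector_derivative
      cis \<theta> * (h $ 1 *\<^sub>R (of_real (signed_curvature \<Gamma> s) * (\<i> * tangent \<Gamma> s)))
      + (- of_real (h $ 2) + \<i> * of_real (cos \<theta> * h $ 2 / sin \<theta>)) * tangent \<Gamma> s) (at r)"
    unfolding su_velocity_def
    using has_vector_derivative_mult[OF dir tan] xr12 by simp
  have dcis: "- of_real (h $ 2) + \<i> * of_real (cos \<theta> * h $ 2 / sin \<theta>)
      = of_real (h $ 2 / sin \<theta>) * (\<i> * cis \<theta>)"
    using sin by (simp add: complex_eq_iff)
  have "cis \<theta> * (h $ 1 *\<^sub>R (of_real (signed_curvature \<Gamma> s) * (\<i> * tangent \<Gamma> s)))
      + (- of_real (h $ 2) + \<i> * of_real (cos \<theta> * h $ 2 / sin \<theta>)) * tangent \<Gamma> s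
      = of_real (signed_curvature \<Gamma> s * h $ 1 + h $ 2 / sin \<theta>) * (\<i> * inward_velocity \<Gamma> (s, \<theta>))"
    unfolding dcis by (simp add: inward_velocity_def scaleR_conv_of_real algebra_simps)
  then show ?thesis using D by simp
qed

text \<open>The linearization of a chord of length \<open>\<alpha> \<mu>\<close> followed by a half turn, where \<open>\<delta>\<close> is the sum of the
  cotangents at the ends of the arc: \<open>(x, \<psi>)\<close> is sent to \<open>(x', \<psi>')\<close> with \<open>x' = - x + \<alpha> \<psi>\<close> and \<open>\<psi>' = - \<psi> + \<delta> x'\<close>.\<close>

definition half_turn_matrix :: "real \<Rightarrow> real \<Rightarrow> real^2^2"
  where "half_turn_matrix \<alpha> \<delta> = vector [vector [- 1, \<alpha>], vector [- \<delta>, \<alpha> * \<delta> - 1]]"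

lemma inner_mult_unit: "(a * v) \<bullet> (b * v) = a \<bullet> b" if "norm v = 1" for a b v :: complex
proof -
  have "(a * v) \<bullet> (b * v) = (a \<bullet> b) * ((Re v)\<^sup>2 + (Im v)\<^sup>2)"
    by (simp add: inner_complex_def power2_eq_square algebra_simps)
  also have "(Re v)\<^sup>2 + (Im v)\<^sup>2 = 1" using that by (simp add: cmod_def)
  finally show ?thesis by simp
qed

text \<open>\<open>E\<close> is the exit point, written as a function of the initial condition and of its image under \<open>T\<close>.
  Along a line through the initial condition, let \<open>a\<close> and \<open>b\<close> be the angular velocities of the
  velocity vectors at the start and at the re-entry. Differentiating the incidence of \<open>E\<close> with the
  line of the chord gives the first row of the matrix (\<open>eq1\<close>), and differentiating its incidence
  with the boundary gives the second row (\<open>eq2\<close>, \<open>eq3\<close>). All vectors are written as complex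
  multiples of the unit vector \<open>v\<close>, which then drops out of the inner products.\<close>

lemma linearized_half_turn_step:
  assumes B: "arc_length_boundary \<Omega> \<Gamma> L" and \<mu>: "\<mu> > 0"
    and step: "billiard_step \<Omega> \<Gamma> \<mu> (s\<^sub>0, \<theta>\<^sub>0) (s\<^sub>1, \<theta>\<^sub>1) (s\<^sub>2, \<theta>\<^sub>2)" and th1: "\<theta>\<^sub>1 \<in> {0<..<pi}"
    and half: "inward_velocity \<Gamma> (s\<^sub>2, \<theta>\<^sub>2) = - inward_velocity \<Gamma> (s\<^sub>0, \<theta>\<^sub>0)"
    and J: "has_billiard_jacobian \<Omega> \<Gamma> \<mu> (s\<^sub>0, \<theta>\<^sub>0) (s\<^sub>2, \<theta>\<^sub>2) D"
  shows "jacobi_matrix \<Gamma> \<mu> (s\<^sub>2, \<theta>\<^sub>2) ** D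
    = half_turn_matrix (dist (\<Gamma> s\<^sub>0) (\<Gamma> s\<^sub>1) / \<mu>) (cot \<theta>\<^sub>1 + cot \<theta>\<^sub>2) ** jacobi_matrix \<Gamma> \<mu> (s\<^sub>0, \<theta>\<^sub>0)"
proof -
  define v where "v = inward_velocity \<Gamma> (s\<^sub>0, \<theta>\<^sub>0)"
  define l where "l = dist (\<Gamma> s\<^sub>0) (\<Gamma> s\<^sub>1)"
  note geo = billiard_step_geometry[OF B step, folded v_def l_def, unfolded half[folded v_def]]
  have v: "norm v = 1" by (rule geo)
  have th0: "\<theta>\<^sub>0 \<in> {0<..<pi}" and th2: "\<theta>\<^sub>2 \<in> {0<..<pi}" by (rule geo)+
  have sin: "sin \<theta>\<^sub>0 > 0" "sin \<theta>\<^sub>1 > 0" "sin \<theta>\<^sub>2 > 0"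
    using th0 th1 th2 by (auto intro: sin_gt_zero)
  have cis_cancel: "T = cis (- \<theta>) * u" if "u = cis \<theta> * T" for T u \<theta>
    unfolding that by (simp add: cis_mult flip: mult.assoc)
  have T0: "tangent \<Gamma> s\<^sub>0 = cis (- \<theta>\<^sub>0) * v"
    by (rule cis_cancel) (simp add: v_def inward_velocity_def)
  have T1: "tangent \<Gamma> s\<^sub>1 = cis \<theta>\<^sub>1 * v"
    unfolding v_def by (rule exit_tangent[OF B \<mu> step th1])
  have T2: "tangent \<Gamma> s\<^sub>2 = - cis (- \<theta>\<^sub>2) * v"
  proof -
    have "- v = cis \<theta>\<^sub>2 * tangent \<Gamma> s\<^sub>2" using half by (simp add: v_def inward_velocity_def)
    from cis_cancel[OF this] show ?thesis by simp
  qed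
  define z where "z = su_coords (s\<^sub>0, \<theta>\<^sub>0)"
  obtain F where Fz: "F z = su_coords (s\<^sub>2, \<theta>\<^sub>2)"
    and near: "\<forall>\<^sub>F x in nhds z. \<exists>z' w'. x = su_coords z' \<and> billiard_map \<Omega> \<Gamma> \<mu> z' w' \<and> F x = su_coords w'"
    and Fd: "F differentiable at z" and D: "D = jacobian F (at z)"
    using J unfolding has_billiard_jacobian_def z_def by auto
  have F': "(F has_derivative (*v) D) (at z)"
    using Fd unfolding D jacobian_works .
  define E where "E = (\<lambda>x. \<Gamma> (F x $ 1) + of_real \<mu> * (\<i> * su_velocity \<Gamma> (F x))
    - of_real \<mu> * (\<i> * su_velocity \<Gamma> x))"
  have E: "\<forall>\<^sub>F x in nhds z. E x \<in> range \<Gamma> \<and> (E x - \<Gamma> (x $ 1)) \<bullet> (\<i> * su_velocity \<Gamma> x) = 0"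
    using near
  proof eventually_elim
    case (elim x)
    then obtain a \<phi> b \<psi> c \<omega> where x: "x = su_coords (a, \<phi>)" "F x = su_coords (b, \<psi>)"
      and st: "billiard_step \<Omega> \<Gamma> \<mu> (a, \<phi>) (c, \<omega>) (b, \<psi>)"
      unfolding billiard_map_def by (metis surj_pair)
    note g = billiard_step_geometry[OF B st]
    have V: "su_velocity \<Gamma> x = inward_velocity \<Gamma> (a, \<phi>)" "su_velocity \<Gamma> (F x) = inward_velocity \<Gamma> (b, \<psi>)"
      using su_velocity_su_coords[OF g(1)] su_velocity_su_coords[OF g(2)] by (metis x)+
    have Ex: "E x = \<Gamma> c" unfolding E_def V using g(7) by (simp add: x(2) algebra_simps)
    have "\<Gamma> c - \<Gamma> a = of_real (dist (\<Gamma> a) (\<Gamma> c)) * su_velocity \<Gamma> x"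
      using g(6) unfolding V by (metis add_diff_cancel_left')
    then have "(E x - \<Gamma> (x $ 1)) \<bullet> (\<i> * su_velocity \<Gamma> x) = 0"
      unfolding Ex by (simp add: x(1) inner_complex_def)
    then show ?case using Ex by simp
  qed
  have "jacobi_matrix \<Gamma> \<mu> (s\<^sub>2, \<theta>\<^sub>2) *v (D *v h)
    = half_turn_matrix (l / \<mu>) (cot \<theta>\<^sub>1 + cot \<theta>\<^sub>2) *v (jacobi_matrix \<Gamma> \<mu> (s\<^sub>0, \<theta>\<^sub>0) *v h)" for h
  proof -
    define k where "k = D *v h"
    define x where "x = (\<lambda>r. z + r *\<^sub>R h)"
    define y where "y = (\<lambda>r. F (x r))"
    define a where "a = signed_curvature \<Gamma> s\<^sub>0 * h $ 1 + h $ 2 / sin \<theta>\<^sub>0"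
    define b where "b = signed_curvature \<Gamma> s\<^sub>2 * k $ 1 + k $ 2 / sin \<theta>\<^sub>2"
    have x': "(x has_vector_derivative h) (at 0)"
      unfolding x_def by (auto intro!: derivative_eq_intros simp: has_vector_derivative_def)
    have y': "(y has_vector_derivative k) (at 0)"
      using vector_derivative_diff_chain_within[of x h 0 UNIV F "(*v) D"] x' F'
      by (simp add: y_def k_def o_def x_def has_derivative_at_withinI)
    have x0: "x 0 = su_coords (s\<^sub>0, \<theta>\<^sub>0)" and y0: "y 0 = su_coords (s\<^sub>2, \<theta>\<^sub>2)"
      by (simp_all add: x_def y_def z_def flip: Fz)
    have V': "((\<lambda>r. su_velocity \<Gamma> (x r)) has_vector_derivative of_real a * (\<i> * v)) (at 0)"
      using su_velocity_derivative[OF B th0 x' x0] by (simp add: a_def v_def)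
    have W': "((\<lambda>r. su_velocity \<Gamma> (y r)) has_vector_derivative of_real b * (\<i> * (- v))) (at 0)"
      using su_velocity_derivative[OF B th2 y' y0] half by (simp add: b_def v_def)
    have P': "((\<lambda>r. \<Gamma> (x r $ 1)) has_vector_derivative h $ 1 *\<^sub>R tangent \<Gamma> s\<^sub>0) (at 0)"
      using vector_diff_chain_at[OF bounded_linear.has_vector_derivative[OF bounded_linear_vec_nth[of 1] x'],
          of \<Gamma> "tangent \<Gamma> s\<^sub>0"] boundary_has_tangent[OF B, of s\<^sub>0] by (simp add: o_def x0)
    have Q': "((\<lambda>r. \<Gamma> (y r $ 1)) has_vector_derivative k $ 1 *\<^sub>R tangent \<Gamma> s\<^sub>2) (at 0)"
      using vector_diff_chain_at[OF bounded_linear.has_vector_derivative[OF bounded_linear_vec_nth[of 1] y'],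
          of \<Gamma> "tangent \<Gamma> s\<^sub>2"] boundary_has_tangent[OF B, of s\<^sub>2] by (simp add: o_def y0)
    define e where "e = of_real (k $ 1) * (- cis (- \<theta>\<^sub>2)) + of_real (\<mu> * (a + b))"
    have E': "((\<lambda>r. E (x r)) has_vector_derivative e * v) (at 0)"
    proof -
      have "((\<lambda>r. E (x r)) has_vector_derivative
          k $ 1 *\<^sub>R tangent \<Gamma> s\<^sub>2 + of_real \<mu> * (\<i> * (of_real b * (\<i> * (- v))))
            - of_real \<mu> * (\<i> * (of_real a * (\<i> * v)))) (at 0)"
        unfolding E_def using Q' W' V' unfolding y_def
        by (intro has_vector_derivative_add has_vector_derivative_diff has_vector_derivative_mult_right)
      then show ?thesis by (simp add: e_def T2 scaleR_conv_of_real algebra_simps)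
    qed
    have E0: "E (x 0) = \<Gamma> s\<^sub>1"
    proof -
      have "su_velocity \<Gamma> (x 0) = v" "su_velocity \<Gamma> (F (x 0)) = - v"
        using y0 unfolding y_def x0 by (simp_all add: su_velocity_su_coords[OF th0] su_velocity_su_coords[OF th2] half v_def)
      then show ?thesis using y0 geo(7) unfolding E_def y_def by (simp add: algebra_simps)
    qed
    have "filterlim x (nhds z) (nhds 0)"
      unfolding x_def by (rule tendsto_eq_intros filterlim_ident refl | simp)+
    from eventually_compose_filterlim[OF E this]
    have near0: "\<forall>\<^sub>F r in nhds 0. E (x r) \<in> range \<Gamma>"
      "\<forall>\<^sub>F r in nhds 0. (E (x r) - \<Gamma> (x r $ 1)) \<bullet> (\<i> * su_velocity \<Gamma> (x r)) = 0"
      by (auto elim: eventually_mono)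
    \<comment> \<open>The exit point moves within the boundary.\<close>
    have "(e * v) \<bullet> (\<i> * tangent \<Gamma> s\<^sub>1) = 0"
      by (rule curve_in_boundary_tangential[OF B E' near0(1) E0])
    then have "e \<bullet> (\<i> * cis \<theta>\<^sub>1) = 0"
      unfolding T1 using inner_mult_unit[OF v, of e "\<i> * cis \<theta>\<^sub>1"] by (simp add: mult.assoc)
    then have eq2: "\<mu> * (a + b) * sin \<theta>\<^sub>1 = k $ 1 * (cos \<theta>\<^sub>2 * sin \<theta>\<^sub>1 + sin \<theta>\<^sub>2 * cos \<theta>\<^sub>1)"
      by (simp add: e_def inner_complex_def algebra_simps)
    \<comment> \<open>The exit point stays on the line of the chord.\<close>
    define g where "g = (\<lambda>r. (E (x r) - \<Gamma> (x r $ 1)) \<bullet> (\<i> * su_velocity \<Gamma> (x r)))"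
    have d: "(g has_vector_derivative
        (E (x 0) - \<Gamma> (x 0 $ 1)) \<bullet> (\<i> * (of_real a * (\<i> * v)))
        + (e * v - h $ 1 *\<^sub>R tangent \<Gamma> s\<^sub>0) \<bullet> (\<i> * su_velocity \<Gamma> (x 0))) (at 0)"
      unfolding g_def by (intro bounded_bilinear.has_vector_derivative[OF bounded_bilinear_inner]
          has_vector_derivative_diff has_vector_derivative_mult_right E' P' V')
    have g: "\<forall>\<^sub>F r in nhds 0. g r = 0" using near0(2) unfolding g_def .
    then have "(g has_vector_derivative 0) (at 0) \<longleftrightarrow> ((\<lambda>_. 0 :: real) has_vector_derivative 0) (at (0::real))"
      using eventually_nhds_x_imp_x[OF g] by (intro has_vector_derivative_cong_ev) simp_all
    then have "(g has_vector_derivative 0) (at 0)" by simp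
    with d have "(E (x 0) - \<Gamma> (x 0 $ 1)) \<bullet> (\<i> * (of_real a * (\<i> * v)))
        + (e * v - h $ 1 *\<^sub>R tangent \<Gamma> s\<^sub>0) \<bullet> (\<i> * su_velocity \<Gamma> (x 0)) = 0"
      using vector_derivative_unique_at by blast
    moreover have "E (x 0) - \<Gamma> (x 0 $ 1) = of_real l * v"
      unfolding E0 by (simp add: x0 geo(6))
    moreover have "e * v - h $ 1 *\<^sub>R tangent \<Gamma> s\<^sub>0 = (e - of_real (h $ 1) * cis (- \<theta>\<^sub>0)) * v"
      unfolding T0 by (simp add: scaleR_conv_of_real algebra_simps)
    moreover have "\<i> * su_velocity \<Gamma> (x 0) = \<i> * v" "\<i> * (of_real a * (\<i> * v)) = (- of_real a) * v"
      unfolding x0 by (simp_all add: su_velocity_su_coords[OF th0] complex_eq_iff flip: v_def)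
    ultimately have "of_real l \<bullet> (- of_real a :: complex) + (e - of_real (h $ 1) * cis (- \<theta>\<^sub>0)) \<bullet> \<i> = 0"
      by (simp only: inner_mult_unit[OF v])
    then have eq1: "k $ 1 * sin \<theta>\<^sub>2 = l * a - h $ 1 * sin \<theta>\<^sub>0"
      by (simp add: e_def inner_complex_def)
    have "\<mu> * (a + b) = (cot \<theta>\<^sub>1 + cot \<theta>\<^sub>2) * (k $ 1 * sin \<theta>\<^sub>2)"
    proof -
      have "\<mu> * (a + b) = \<mu> * (a + b) * sin \<theta>\<^sub>1 / sin \<theta>\<^sub>1" using sin by simp
      also have "\<dots> = (cot \<theta>\<^sub>1 + cot \<theta>\<^sub>2) * (k $ 1 * sin \<theta>\<^sub>2)"
        unfolding eq2 using sin by (simp add: cot_def field_simps)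
      finally show ?thesis .
    qed
    then have eq3: "\<mu> * b = (cot \<theta>\<^sub>1 + cot \<theta>\<^sub>2) * (k $ 1 * sin \<theta>\<^sub>2) - \<mu> * a"
      by (simp add: algebra_simps)
    have M0: "jacobi_matrix \<Gamma> \<mu> (s\<^sub>0, \<theta>\<^sub>0) *v h = vector [sin \<theta>\<^sub>0 * h $ 1, \<mu> * a]"
      by (simp add: vec_eq_iff forall_2 matrix_vector_mult_def sum_2 jacobi_matrix_def a_def algebra_simps)
    have M2: "jacobi_matrix \<Gamma> \<mu> (s\<^sub>2, \<theta>\<^sub>2) *v k = vector [sin \<theta>\<^sub>2 * k $ 1, \<mu> * b]"
      by (simp add: vec_eq_iff forall_2 matrix_vector_mult_def sum_2 jacobi_matrix_def b_def algebra_simps)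
    show ?thesis
      unfolding k_def[symmetric] M0 M2 eq3 mult.commute[of "sin \<theta>\<^sub>2"] eq1 using \<mu>
      by (simp add: vec_eq_iff forall_2 matrix_vector_mult_def sum_2 half_turn_matrix_def algebra_simps)
  qed
  then show ?thesis unfolding matrix_eq by (simp add: l_def matrix_vector_mul_assoc)
qed

section \<open>The trace of the stability matrix\<close>

lemma trace_two_half_turns:
  "trace (half_turn_matrix \<alpha> \<beta> ** half_turn_matrix \<alpha> \<delta>) = 2 - 2 * \<alpha> * \<beta> - 2 * \<alpha> * \<delta> + \<alpha>\<^sup>2 * \<beta> * \<delta>"
  by (simp add: trace_def sum_2 matrix_matrix_mult_def half_turn_matrix_def power2_eq_square algebra_simps)

text \<open>If \<open>D\<close> and \<open>D'\<close> are represented by \<open>A\<close> and \<open>A'\<close> after changes of coordinates \<open>M\<close> at one point of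
  a cycle of length two and \<open>N\<close> at the other, then their product around the cycle is conjugate to
  that of \<open>A\<close> and \<open>A'\<close> by \<open>M\<close>.\<close>

lemma trace_conjugate:
  fixes M N A A' D D' :: "real^'n^'n"
  assumes "invertible M" and 1: "N ** D = A ** M" and 2: "M ** D' = A' ** N"
  shows "trace (D' ** D) = trace (A' ** A)"
proof -
  obtain K where K: "M ** K = mat 1" "K ** M = mat 1" using assms(1) unfolding invertible_def by blast
  have "D' ** D = K ** (M ** D') ** D"
    by (simp add: matrix_mul_assoc K)
  also have "\<dots> = K ** (A' ** (N ** D))" unfolding 2 by (simp add: matrix_mul_assoc)
  also have "\<dots> = K ** (A' ** A ** M)" unfolding 1 by (simp add: matrix_mul_assoc)
  also have "trace \<dots> = trace (A' ** A ** M ** K)" by (rule trace_mul_sym)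
  also have "A' ** A ** M ** K = A' ** A" by (simp add: K flip: matrix_mul_assoc)
  finally show ?thesis .
qed

lemma jacobi_matrix_invertible:
  assumes "\<mu> \<noteq> 0" "sin \<theta> \<noteq> 0"
  shows "invertible (jacobi_matrix \<Gamma> \<mu> (s, \<theta>))"
  using assms by (simp add: invertible_det_nz det_2 jacobi_matrix_def)

text \<open>By the stadium shape both steps are half turns with the same \<open>\<alpha>\<close>. The second one, from \<open>P\<^sub>2\<close> to
  \<open>P\<^sub>0\<close>, passes the boundary at the angles \<open>\<theta>\<^sub>3\<close> and \<open>\<theta>\<^sub>0\<close>, which is why \<open>\<beta>\<close> pairs these two.\<close>

lemma two_periodic_trace:
  assumes B: "arc_length_boundary \<Omega> \<Gamma> L" and \<mu>: "\<mu> > 0"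
    and per: "two_periodic_trajectory \<Omega> \<Gamma> \<mu> (s\<^sub>0, \<theta>\<^sub>0) (s\<^sub>1, \<theta>\<^sub>1) (s\<^sub>2, \<theta>\<^sub>2) (s\<^sub>3, \<theta>\<^sub>3)"
    and th: "\<theta>\<^sub>1 \<in> {0<..<pi}" "\<theta>\<^sub>3 \<in> {0<..<pi}"
    and J: "has_billiard_jacobian \<Omega> \<Gamma> \<mu> (s\<^sub>0, \<theta>\<^sub>0) (s\<^sub>2, \<theta>\<^sub>2) D\<^sub>0"
      "has_billiard_jacobian \<Omega> \<Gamma> \<mu> (s\<^sub>2, \<theta>\<^sub>2) (s\<^sub>0, \<theta>\<^sub>0) D\<^sub>2"
  defines "\<alpha> \<equiv> dist (\<Gamma> s\<^sub>0) (\<Gamma> s\<^sub>1) / \<mu>"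
    and "\<beta> \<equiv> cot \<theta>\<^sub>0 + cot \<theta>\<^sub>3" and "\<delta> \<equiv> cot \<theta>\<^sub>1 + cot \<theta>\<^sub>2"
  shows "\<alpha> > 0" and "trace (D\<^sub>2 ** D\<^sub>0) = 2 - 2 * \<alpha> * \<beta> - 2 * \<alpha> * \<delta> + \<alpha>\<^sup>2 * \<beta> * \<delta>"
proof -
  have s: "billiard_step \<Omega> \<Gamma> \<mu> (s\<^sub>0, \<theta>\<^sub>0) (s\<^sub>1, \<theta>\<^sub>1) (s\<^sub>2, \<theta>\<^sub>2)"
    "billiard_step \<Omega> \<Gamma> \<mu> (s\<^sub>2, \<theta>\<^sub>2) (s\<^sub>3, \<theta>\<^sub>3) (s\<^sub>0, \<theta>\<^sub>0)"
    using per by (auto simp: two_periodic_trajectory_def)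
  note st = two_periodic_stadium[OF B per]
  show "\<alpha> > 0" using billiard_step_geometry(5)[OF B s(1)] \<mu> by (simp add: \<alpha>_def)
  have "sin \<theta>\<^sub>0 > 0" using billiard_step_geometry(1)[OF B s(1)] sin_gt_zero by auto
  then have inv: "invertible (jacobi_matrix \<Gamma> \<mu> (s\<^sub>0, \<theta>\<^sub>0))"
    using \<mu> by (intro jacobi_matrix_invertible) auto
  have "jacobi_matrix \<Gamma> \<mu> (s\<^sub>2, \<theta>\<^sub>2) ** D\<^sub>0 = half_turn_matrix \<alpha> \<delta> ** jacobi_matrix \<Gamma> \<mu> (s\<^sub>0, \<theta>\<^sub>0)"
    using linearized_half_turn_step[OF B \<mu> s(1) th(1) st(1) J(1)] by (simp add: \<alpha>_def \<delta>_def)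
  moreover have "jacobi_matrix \<Gamma> \<mu> (s\<^sub>0, \<theta>\<^sub>0) ** D\<^sub>2 = half_turn_matrix \<alpha> \<beta> ** jacobi_matrix \<Gamma> \<mu> (s\<^sub>2, \<theta>\<^sub>2)"
    using linearized_half_turn_step[OF B \<mu> s(2) th(2) _ J(2)] st by (simp add: \<alpha>_def \<beta>_def add.commute)
  ultimately show "trace (D\<^sub>2 ** D\<^sub>0) = 2 - 2 * \<alpha> * \<beta> - 2 * \<alpha> * \<delta> + \<alpha>\<^sup>2 * \<beta> * \<delta>"
    using trace_conjugate[OF inv] trace_two_half_turns by metis
qed

section \<open>Signs of the trace\<close>

lemma trace_trichotomy:
  "parabolic S \<longleftrightarrow> trace S + 2 = 0 \<or> trace S - 2 = 0"
  "elliptic S \<longleftrightarrow> trace S + 2 > 0 \<and> trace S - 2 < 0"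
  "hyperbolic S \<longleftrightarrow> trace S + 2 < 0 \<or> trace S - 2 > 0"
  by (auto simp: parabolic_def elliptic_def hyperbolic_def)

text \<open>From here on only the trace formula matters. It is symmetric in \<open>\<beta>\<close> and \<open>\<delta>\<close>, so each case proved
  here also holds with the two interchanged (\<open>swap\<close>).\<close>

locale stability_trace =
  fixes S :: "real^2^2" and \<alpha> \<beta> \<delta> :: real
  assumes \<alpha>: "\<alpha> > 0" and tr: "trace S = 2 - 2 * \<alpha> * \<beta> - 2 * \<alpha> * \<delta> + \<alpha>\<^sup>2 * \<beta> * \<delta>"
begin

lemma trace_plus: "trace S + 2 = (2 - \<alpha> * \<beta>) * (2 - \<alpha> * \<delta>)"
  by (simp add: tr power2_eq_square algebra_simps)

lemma trace_minus: "trace S - 2 = \<alpha> * (\<alpha> * (\<beta> * \<delta>) - 2 * (\<beta> + \<delta>))"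
  by (simp add: tr power2_eq_square algebra_simps)

lemma swap: "stability_trace S \<alpha> \<delta> \<beta>"
  by unfold_locales (use \<alpha> tr in \<open>simp_all add: algebra_simps\<close>)

lemma parabolic_of_zero: "\<beta> = 0 \<Longrightarrow> \<delta> = 0 \<Longrightarrow> parabolic S"
  by (simp add: parabolic_def tr)

lemma hyperbolic_of_nonpos:
  assumes "\<beta> \<le> 0" "\<delta> \<le> 0" "\<not> (\<beta> = 0 \<and> \<delta> = 0)"
  shows "hyperbolic S"
proof -
  have "p - 2 * q > 0" if "p \<ge> 0" "q < 0" for p q :: real using that by simp
  moreover have "\<alpha> * (\<beta> * \<delta>) \<ge> 0" using \<alpha> assms by (simp add: mult_nonpos_nonpos)
  moreover have "\<beta> + \<delta> < 0" using assms by (cases "\<beta> = 0") auto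
  ultimately have "\<alpha> * (\<beta> * \<delta>) - 2 * (\<beta> + \<delta>) > 0" by blast
  then show ?thesis unfolding trace_trichotomy trace_minus using \<alpha> by simp
qed

lemma sign_of_factor:
  assumes "\<beta> > 0"
  shows "2 - \<alpha> * \<beta> = 0 \<longleftrightarrow> \<alpha> = 2 / \<beta>" "2 - \<alpha> * \<beta> > 0 \<longleftrightarrow> \<alpha> < 2 / \<beta>" "2 - \<alpha> * \<beta> < 0 \<longleftrightarrow> \<alpha> > 2 / \<beta>"
  using assms by (auto simp: field_simps)

lemma factor_pos_of_nonpos: "\<delta> \<le> 0 \<Longrightarrow> 2 - \<alpha> * \<delta> > 0"
  using \<alpha> mult_nonneg_nonpos[of \<alpha> \<delta>] by simp

lemma trace_minus_intervals:
  assumes "\<beta> \<noteq> 0" "\<delta> \<noteq> 0"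
  shows "trace S - 2 = \<alpha> * (\<beta> * \<delta>) * (\<alpha> - (2 / \<beta> + 2 / \<delta>))"
  unfolding trace_minus using assms by (simp add: field_simps)

text \<open>The second factor of \<open>trace S + 2\<close> is positive and \<open>trace S - 2\<close> is negative throughout, so only the
  first factor changes the type, at \<open>\<alpha> = 2 / \<beta>\<close>.\<close>

lemma single_threshold:
  assumes "(\<beta> > 0 \<and> \<delta> = 0) \<or> (\<beta> > 0 \<and> \<delta> < 0 \<and> 2 / \<beta> + 2 / \<delta> \<le> 0)"
  shows "(parabolic S \<longleftrightarrow> \<alpha> = 2 / \<beta>) \<and>
      (elliptic S \<longleftrightarrow> \<alpha> \<in> {0<..<2 / \<beta>}) \<and>
      (hyperbolic S \<longleftrightarrow> \<alpha> \<in> {2 / \<beta><..})"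
proof -
  have b: "\<beta> > 0" and d: "\<delta> \<le> 0" using assms by auto
  have "trace S - 2 < 0"
  proof (cases "\<delta> = 0")
    case True
    then show ?thesis using b \<alpha> by (simp add: trace_minus)
  next
    case False
    then have "\<alpha> * (\<beta> * \<delta>) < 0" "\<alpha> - (2 / \<beta> + 2 / \<delta>) > 0"
      using assms \<alpha> by (auto simp: mult_pos_neg)
    then show ?thesis using b False by (simp add: trace_minus_intervals mult_neg_pos)
  qed
  moreover have "2 - \<alpha> * \<delta> > 0" by (rule factor_pos_of_nonpos[OF d])
  ultimately show ?thesis
    unfolding trace_trichotomy trace_plus using sign_of_factor[OF b] \<alpha>
    by (auto simp: zero_less_mult_iff mult_less_0_iff)
qed

text \<open>Now \<open>trace S - 2\<close> also changes its sign at a positive \<open>\<alpha>\<close>, namely at \<open>2 / \<beta> + 2 / \<delta>\<close>, which is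
  smaller than \<open>2 / \<beta>\<close>.\<close>

lemma two_thresholds:
  assumes b: "\<beta> > 0" and d: "\<delta> < 0" and p: "2 / \<beta> + 2 / \<delta> > 0"
  shows "(parabolic S \<longleftrightarrow> \<alpha> = 2 / \<beta> \<or> \<alpha> = 2 / \<beta> + 2 / \<delta>) \<and>
      (elliptic S \<longleftrightarrow> \<alpha> \<in> {2 / \<beta> + 2 / \<delta><..<2 / \<beta>}) \<and>
      (hyperbolic S \<longleftrightarrow> \<alpha> \<in> {0<..<2 / \<beta> + 2 / \<delta>} \<union> {2 / \<beta><..})"
proof -
  have "\<alpha> * (\<beta> * \<delta>) < 0" using b d \<alpha> by (simp add: mult_pos_neg)
  then have "trace S - 2 = 0 \<longleftrightarrow> \<alpha> = 2 / \<beta> + 2 / \<delta>" "trace S - 2 < 0 \<longleftrightarrow> \<alpha> > 2 / \<beta> + 2 / \<delta>"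
    "trace S - 2 > 0 \<longleftrightarrow> \<alpha> < 2 / \<beta> + 2 / \<delta>"
    using b d trace_minus_intervals by (auto simp: zero_less_mult_iff mult_less_0_iff)
  moreover have "2 - \<alpha> * \<delta> > 0" by (rule factor_pos_of_nonpos) (use d in simp)
  ultimately show ?thesis
    unfolding trace_trichotomy trace_plus using sign_of_factor[OF b] \<alpha>
    by (auto simp: zero_less_mult_iff mult_less_0_iff)
qed

text \<open>Up to the positive factor \<open>\<beta> \<delta>\<close>, the trace plus 2 is \<open>(\<alpha> - m) (\<alpha> - M)\<close>; the trace minus 2
  changes its sign at \<open>m + M\<close>, beyond both zeros.\<close>

lemma positive_signs:
  assumes b: "\<beta> > 0" and d: "\<delta> > 0"
  defines "m \<equiv> min (2 / \<beta>) (2 / \<delta>)" and "M \<equiv> max (2 / \<beta>) (2 / \<delta>)"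
  shows "parabolic S \<longleftrightarrow> \<alpha> \<in> {m, M, m + M}"
    and "elliptic S \<longleftrightarrow> \<alpha> \<in> {0<..<m} \<union> {M<..<m + M}"
    and "hyperbolic S \<longleftrightarrow> \<alpha> \<in> {m<..<M} \<union> {m + M<..}"
proof -
  have mM: "2 / \<beta> + 2 / \<delta> = m + M" by (simp add: m_def M_def min_def max_def)
  have "m > 0" using b d by (simp add: m_def)
  have "\<alpha> * (\<beta> * \<delta>) > 0" using b d \<alpha> by simp
  then have minus: "trace S - 2 = 0 \<longleftrightarrow> \<alpha> = m + M" "trace S - 2 < 0 \<longleftrightarrow> \<alpha> < m + M"
    "trace S - 2 > 0 \<longleftrightarrow> \<alpha> > m + M"
    using b d trace_minus_intervals mM by (auto simp: zero_less_mult_iff mult_less_0_iff)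
  note f = sign_of_factor[OF b] stability_trace.sign_of_factor[OF swap d]
  have plus: "trace S + 2 = 0 \<longleftrightarrow> \<alpha> = m \<or> \<alpha> = M"
    "trace S + 2 < 0 \<longleftrightarrow> m < \<alpha> \<and> \<alpha> < M"
    "trace S + 2 > 0 \<longleftrightarrow> \<alpha> < m \<or> M < \<alpha>"
    unfolding trace_plus zero_less_mult_iff mult_less_0_iff mult_eq_0_iff f
    by (auto simp: m_def M_def min_def max_def)
  show "parabolic S \<longleftrightarrow> \<alpha> \<in> {m, M, m + M}"
    and "elliptic S \<longleftrightarrow> \<alpha> \<in> {0<..<m} \<union> {M<..<m + M}"
    and "hyperbolic S \<longleftrightarrow> \<alpha> \<in> {m<..<M} \<union> {m + M<..}"
    unfolding trace_trichotomy minus plus using \<alpha> \<open>m > 0\<close>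
    by (auto simp: m_def M_def min_def max_def split: if_splits)
qed

lemma positive_signs_equal:
  assumes b: "\<beta> > 0" and "\<beta> = \<delta>"
  shows "parabolic S \<longleftrightarrow> \<alpha> \<in> {2 / \<beta>, 2 * (2 / \<beta>)}"
    and "elliptic S \<longleftrightarrow> \<alpha> \<in> {0<..<2 / \<beta>} \<union> {2 / \<beta><..<2 * (2 / \<beta>)}"
    and "hyperbolic S \<longleftrightarrow> \<alpha> \<in> {2 * (2 / \<beta>)<..}"
  using positive_signs[OF b] b unfolding \<open>\<beta> = \<delta>\<close>[symmetric] by simp_all

end

section \<open>Stability of two-periodic orbits\<close>

theorem theorem3p9:
  fixes \<Omega> :: "complex set" and \<Gamma> :: "real \<Rightarrow> complex" and L \<mu> :: real
    and s\<^sub>0 s\<^sub>1 s\<^sub>2 s\<^sub>3 \<theta>\<^sub>0 \<theta>\<^sub>1 \<theta>\<^sub>2 \<theta>\<^sub>3 :: real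
    and D\<^sub>0 D\<^sub>2 S :: "real^2^2" and \<alpha> \<beta> \<delta> :: real
  assumes "bounded \<Omega>" and "open \<Omega>" and "connected \<Omega>"
    and "arc_length_boundary \<Omega> \<Gamma> L"
    and "not_strictly_convex \<Gamma> \<or> concave_boundary \<Gamma>"
    and "\<mu> > 0"
    and "two_periodic_trajectory \<Omega> \<Gamma> \<mu> (s\<^sub>0, \<theta>\<^sub>0) (s\<^sub>1, \<theta>\<^sub>1) (s\<^sub>2, \<theta>\<^sub>2) (s\<^sub>3, \<theta>\<^sub>3)"
    and "\<theta>\<^sub>0 \<in> {0<..<pi}" and "\<theta>\<^sub>1 \<in> {0<..<pi}" and "\<theta>\<^sub>2 \<in> {0<..<pi}" and "\<theta>\<^sub>3 \<in> {0<..<pi}"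
    and "has_billiard_jacobian \<Omega> \<Gamma> \<mu> (s\<^sub>0, \<theta>\<^sub>0) (s\<^sub>2, \<theta>\<^sub>2) D\<^sub>0"
    and "has_billiard_jacobian \<Omega> \<Gamma> \<mu> (s\<^sub>2, \<theta>\<^sub>2) (s\<^sub>0, \<theta>\<^sub>0) D\<^sub>2"
    and "S = D\<^sub>2 ** D\<^sub>0"
    and "\<alpha> = dist (\<Gamma> s\<^sub>0) (\<Gamma> s\<^sub>1) / \<mu>"
    and "\<beta> = cot \<theta>\<^sub>0 + cot \<theta>\<^sub>3"
    and "\<delta> = cot \<theta>\<^sub>1 + cot \<theta>\<^sub>2"
  shows "
    (\<beta> = 0 \<and> \<delta> = 0 \<longrightarrow> parabolic S) \<and>
    (\<beta> \<le> 0 \<and> \<delta> \<le> 0 \<and> \<not> (\<beta> = 0 \<and> \<delta> = 0) \<longrightarrow> hyperbolic S) \<and>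
    ((\<beta> > 0 \<and> \<delta> = 0) \<or> (\<beta> > 0 \<and> \<delta> < 0 \<and> 2 / \<beta> + 2 / \<delta> \<le> 0) \<longrightarrow>
      (parabolic S \<longleftrightarrow> \<alpha> = 2 / \<beta>) \<and>
      (elliptic S \<longleftrightarrow> \<alpha> \<in> {0<..<2 / \<beta>}) \<and>
      (hyperbolic S \<longleftrightarrow> \<alpha> \<in> {2 / \<beta><..})) \<and>
    ((\<delta> > 0 \<and> \<beta> = 0) \<or> (\<delta> > 0 \<and> \<beta> < 0 \<and> 2 / \<delta> + 2 / \<beta> \<le> 0) \<longrightarrow>
      (parabolic S \<longleftrightarrow> \<alpha> = 2 / \<delta>) \<and>
      (elliptic S \<longleftrightarrow> \<alpha> \<in> {0<..<2 / \<delta>}) \<and>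
      (hyperbolic S \<longleftrightarrow> \<alpha> \<in> {2 / \<delta><..})) \<and>
    (\<beta> > 0 \<and> \<delta> < 0 \<and> 2 / \<beta> + 2 / \<delta> > 0 \<longrightarrow>
      (parabolic S \<longleftrightarrow> \<alpha> = 2 / \<beta> \<or> \<alpha> = 2 / \<beta> + 2 / \<delta>) \<and>
      (elliptic S \<longleftrightarrow> \<alpha> \<in> {2 / \<beta> + 2 / \<delta><..<2 / \<beta>}) \<and>
      (hyperbolic S \<longleftrightarrow> \<alpha> \<in> {0<..<2 / \<beta> + 2 / \<delta>} \<union> {2 / \<beta><..})) \<and>
    (\<delta> > 0 \<and> \<beta> < 0 \<and> 2 / \<delta> + 2 / \<beta> > 0 \<longrightarrow>
      (parabolic S \<longleftrightarrow> \<alpha> = 2 / \<delta> \<or> \<alpha> = 2 / \<delta> + 2 / \<beta>) \<and>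
      (elliptic S \<longleftrightarrow> \<alpha> \<in> {2 / \<delta> + 2 / \<beta><..<2 / \<delta>}) \<and>
      (hyperbolic S \<longleftrightarrow> \<alpha> \<in> {0<..<2 / \<delta> + 2 / \<beta>} \<union> {2 / \<delta><..})) \<and>
    (\<beta> > 0 \<and> \<delta> > 0 \<longrightarrow>
      (let m = min (2 / \<beta>) (2 / \<delta>); M = max (2 / \<beta>) (2 / \<delta>) in
        (\<beta> \<noteq> \<delta> \<longrightarrow>
          (parabolic S \<longleftrightarrow> \<alpha> \<in> {m, M, m + M}) \<and>
          (elliptic S \<longleftrightarrow> \<alpha> \<in> {0<..<m} \<union> {M<..<m + M}) \<and>
          (hyperbolic S \<longleftrightarrow> \<alpha> \<in> {m<..<M} \<union> {m + M<..})) \<and>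
        (\<beta> = \<delta> \<longrightarrow>
          m = M \<and>
          (parabolic S \<longleftrightarrow> \<alpha> \<in> {m, 2 * m}) \<and>
          (elliptic S \<longleftrightarrow> \<alpha> \<in> {0<..<m} \<union> {m<..<2 * m}) \<and>
          (hyperbolic S \<longleftrightarrow> \<alpha> \<in> {2 * m<..}))))"
proof -
  have per: "two_periodic_trajectory \<Omega> \<Gamma> \<mu> (s\<^sub>0, \<theta>\<^sub>0) (s\<^sub>1, \<theta>\<^sub>1) (s\<^sub>2, \<theta>\<^sub>2) (s\<^sub>3, \<theta>\<^sub>3)" by fact
  interpret stability_trace S \<alpha> \<beta> \<delta>
    using two_periodic_trace[OF assms(4) \<open>\<mu> > 0\<close> per assms(9,11,12,13)] assms(14-17)
    by unfold_locales simp_all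
  interpret swapped: stability_trace S \<alpha> \<delta> \<beta> by (rule swap)
  show ?thesis
    apply (intro conjI[of "_ \<longrightarrow> _"] impI)
    subgoal using parabolic_of_zero by blast
    subgoal using hyperbolic_of_nonpos by blast
    subgoal by (rule single_threshold)
    subgoal by (rule swapped.single_threshold)
    subgoal using two_thresholds by blast
    subgoal using swapped.two_thresholds by blast
    subgoal unfolding Let_def using positive_signs positive_signs_equal by simp
    done
qed

end
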